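(* Let $X$ be a finite-dimensional Euclidean space, let $n,h\ge 1$ be integers, let $\mathcal N=\{1,\dots,n\}$, $\mathcal H=\{0,\dots,h-1\}$, and let $\mathcal K(X)$ be the set of nonempty compact subsets of $X$. Let $\sigma:\mathcal K(X)\to\mathcal S$ be continuous with respect to the Hausdorff metric and such that: (1) for all $S\in\mathcal K(X)$, $S\subseteq\sigma(S)$, with equality if $S$ is a singleton; (2) $\sigma(\sigma(S))=\sigma(S)$ for all $S\in\mathcal K(X)$; (3) $S'\subseteq S$ implies $\sigma(S')\subseteq\sigma(S)$ for all $S,S'\in\mathcal K(X)$; (4) if $S\in\mathcal K(X)$ is not a singleton, then for every $x\in S$ there exists a set $\Sigma_x\subseteq \mathrm{r}\partial\,\sigma(S)$ (depending on $S$ and $x$) such that $\Sigma_x\cap S\ne\emptyset$, $x\notin\Sigma_x$, and for every $S'\in\mathcal K(X)$ with $S'\subseteq\sigma(S)$: (a) if $\mathrm{ri}\,\sigma(S')\cap\Sigma_x\neq\emptyset$ then $S'\subseteq\Sigma_x$; (b) if $d_{\sigma(S)}(S',\Sigma_x)>0$ then $\mu(\sigma(S'))<\mu(\sigma(S))$; (5) $\mu\circ\sigma:\mathcal K(X)\to\mathbb R$ is continuous. For every $k\in\mathcal N$ and every directed graph with delays $\mathcal A$, let $e_k(\mathcal A):X^{hn}\rightrightarrows X$ be a continuous set-valued map with nonempty compact values such that, for every $\tilde x=(x_{i,j})_{i\in\mathcal N,j\in\mathcal H}\in X^{hn}$ (writing $x_k=x_{k,0}$): (i) $e_k(\mathcal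 A)(\tilde x)=\{x_k\}$ if $\{x_{i,j} : ((i,j),k)\in\mathcal A\}\subseteq\{x_k\}$ (in particular if no arc of $\mathcal A$ ends at $k$); (ii) $e_k(\mathcal A)(\tilde x)\subset \mathrm{ri}\,\sigma\big(\{x_k\}\cup\{x_{i,j} : ((i,j),k)\in\mathcal A\}\big)$ (strict inclusion) otherwise. Let $(\mathcal A(t))_{t\in\mathbb N}$ be a sequence of directed graphs with delays, and consider the system $$x_k(t+1)\in e_k(\mathcal A(t))(\tilde x(t)),\qquad k\in\mathcal N,\ t\in\mathbb N,$$ where $\tilde x(t)\in X^{hn}$ has components $x_{k,j}(t)=x_k(t-j)$. Then this system, regarded as a difference inclusion with state $\tilde x(t)\in X^{hn}$, is uniformly globally attractive with respect to the collection of equilibrium solutions $x_1(t)\equiv\dots\equiv x_n(t)\equiv\text{constant}$ if and only if there exists $T\ge 0$ such that for all $t_0\in\mathbb N$ there is a node connected to all other nodes across $[t_0,t_0+T]$.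
   Context: Sets and lengths. $\mathcal S$ denotes the set of nonempty compact sets $S\subset X$ for which there is a bijection $\varphi:X\to X$ with $\varphi$ and $\varphi^{-1}$ Lipschitz and $\varphi(S)$ convex. For $S\in\mathcal S$ and $x^0,x^1\in S$, $d_S(x^0,x^1)$ is the infimum of the lengths $\int_0^1\|\psi'(\lambda)\|\,d\lambda$ over Lipschitz maps $\psi:[0,1]\to S$ with $\psi(0)=x^0$, $\psi(1)=x^1$. For subsets $S',S''\subseteq S$, $d_S(S',S'')=\inf_{x^0\in S',x^1\in S''}d_S(x^0,x^1)$. Put $\mu(S)=\max_{x^0,x^1\in S}d_S(x^0,x^1)$. For $S\in\mathcal S$ and any bijection $\varphi:X\to X$ with $\varphi$ and $\varphi^{-1}$ Lipschitz and $\varphi(S)$ convex, $\mathrm{ri}(S)=\varphi^{-1}(\mathrm{ri}(\varphi(S)))$, where $\mathrm{ri}$ of a convex set is its interior in its affine hull; this does not depend on $\varphi$ (by convention, $\mathrm{ri}(S)=\emptyset$ if $S$ is a singleton). The relative boundary is $\mathrm{r}\partial(S)=S\setminus\mathrm{ri}(S)$. Graphs. A directed graph with delays is a subset $\mathcal A\subseteq(\mathcal N\times\mathcal H)\times\mathcal N$ with $((k,0),k)\notin\mathcal A$ for all $k\in\mathcal N$. Elements of $\mathcal N$ are nodes; an element $((k,j),l)\in\mathcal A$ is an arc from $k$ to $l$. Node $k$ is connected to node $l$ if there is a path from $k$ to $l$ respecting the orientation of arcs. For a sequence $\mathcal A(t)$, $k$ is connected to $l$ across an interval $I\subseteq\mathbb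 N$ if $k$ is connected to $l$ in the graph with delays $\bigcup_{t\in I}\mathcal A(t)$. State-space form. The system is viewed as the difference inclusion on $\mathcal X=X^{hn}$ in which, given $\tilde x(t)$, one has $x_{k,0}(t+1)\in e_k(\mathcal A(t))(\tilde x(t))$ and $x_{k,j}(t+1)=x_{k,j-1}(t)$ for $1\le j\le h-1$. Solutions may start at any $t_0\in\mathbb N$ from any $\tilde x(t_0)\in X^{hn}$. The set of equilibrium points corresponding to the considered collection of equilibrium solutions is $\Phi=\{\tilde x\in X^{hn}:\text{all } hn \text{ components } x_{k,j}\text{ are equal}\}$. Attractivity. A difference inclusion $x(t+1)\in e(t,x(t))$ on a Euclidean space $\mathcal X$ is uniformly globally attractive with respect to a collection of equilibrium solutions with set of equilibrium points $\Phi$ if for each $\varphi_1\in\Phi$ and all $c_1,c_2>0$ there is $T\ge0$ such that for all $t_0\in\mathbb N$ every solution $\zeta$ satisfies: if $|\zeta(t_0)-\varphi_1|<c_1$ then there is $\varphi_2\in\Phi$ such that $|\zeta(t)-\varphi_2|<c_2$ for all $t\ge t_0+T$. *)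

theory Defs
  imports "HOL-Analysis.Analysis"
begin

section \<open>The Hausdorff metric on nonempty compact sets\<close>

definition nonempty_compacts :: "'a::metric_space set set" where
  "nonempty_compacts = {S. compact S \<and> S \<noteq> {}}"

text \<open>The value 0 outside bounded nonempty sets is a totalisation.\<close>

definition hausdist :: "'a::metric_space set \<Rightarrow> 'a set \<Rightarrow> real" where
  "hausdist S T =
    (if S \<noteq> {} \<and> T \<noteq> {} \<and> bounded S \<and> bounded T
     then max (SUP x\<in>S. infdist x T) (SUP y\<in>T. infdist y S) else 0)"

lemma bdd_above_infdist:
  fixes S T :: "'a::metric_space set"
  assumes "bounded S" "T \<noteq> {}"
  shows "bdd_above ((\<lambda>x. infdist x T) ` S)"
proof -
  obtain t where t: "t \<in> T" using assms(2) by blast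
  obtain B where B: "\<And>x. x \<in> S \<Longrightarrow> dist t x \<le> B"
    using assms(1) bounded_any_center[of S t] by blast
  have "infdist x T \<le> B" if "x \<in> S" for x
    using infdist_le[OF t, of x] B[OF that] by (simp add: dist_commute)
  then show ?thesis by (rule bdd_aboveI2)
qed

lemma hausdist_infdist_le:
  assumes "bounded S" "bounded T" "T \<noteq> {}" "x \<in> S"
  shows "infdist x T \<le> hausdist S T"
proof -
  have "infdist x T \<le> (SUP x\<in>S. infdist x T)"
    using bdd_above_infdist[OF assms(1,3)] assms(4) by (intro cSUP_upper) auto
  moreover have "S \<noteq> {}" using assms(4) by blast
  ultimately show ?thesis using assms by (simp add: hausdist_def)
qed

lemma hausdist_commute: "hausdist S T = hausdist T S"
  by (auto simp: hausdist_def max.commute)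

lemma hausdist_leI:
  assumes "0 \<le> r" "\<And>x. x \<in> S \<Longrightarrow> infdist x T \<le> r" "\<And>y. y \<in> T \<Longrightarrow> infdist y S \<le> r"
  shows "hausdist S T \<le> r"
  using assms by (auto simp: hausdist_def intro!: cSUP_least)

lemma hausdist_nonneg: "0 \<le> hausdist S T"
proof (cases "S \<noteq> {} \<and> T \<noteq> {} \<and> bounded S \<and> bounded T")
  case True
  then obtain x where "x \<in> S" by blast
  then show ?thesis using hausdist_infdist_le[of S T x] True infdist_nonneg[of x T] by linarith
qed (auto simp: hausdist_def)

lemma Metric_space_hausdist:
  "Metric_space (nonempty_compacts :: 'a::heine_borel set set) hausdist"
proof
  fix S T U :: "'a set"
  show "0 \<le> hausdist S T" by (rule hausdist_nonneg)
  show "hausdist S T = hausdist T S" by (rule hausdist_commute)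
  assume S: "S \<in> nonempty_compacts" and T: "T \<in> nonempty_compacts"
  have sub: "S \<subseteq> T" if "hausdist S T = 0" "S \<in> nonempty_compacts" "T \<in> nonempty_compacts"
    for S T :: "'a set"
  proof
    fix x assume "x \<in> S"
    then have "infdist x T = 0"
      using hausdist_infdist_le[of S T x] that infdist_nonneg[of x T]
      by (auto simp: nonempty_compacts_def compact_imp_bounded)
    then show "x \<in> T"
      using that(3) in_closed_iff_infdist_zero[of T x]
      by (auto simp: nonempty_compacts_def compact_imp_closed)
  qed
  show "hausdist S T = 0 \<longleftrightarrow> S = T"
  proof
    assume "hausdist S T = 0"
    then show "S = T" using sub[of S T] sub[of T S] S T by (simp add: hausdist_commute)
  next
    assume "S = T"
    then show "hausdist S T = 0"
      using hausdist_leI[of 0 S T] hausdist_nonneg[of S T] by force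
  qed
  assume U: "U \<in> nonempty_compacts"
  have half: "infdist x U \<le> hausdist S T + hausdist T U"
    if x: "x \<in> S" and STU: "S \<in> nonempty_compacts" "T \<in> nonempty_compacts" "U \<in> nonempty_compacts"
    for x and S T U :: "'a set"
  proof -
    obtain y where y: "y \<in> T" "infdist x T = dist x y"
      using infdist_attains_inf[of T x] STU
      unfolding nonempty_compacts_def by (blast intro: compact_imp_closed)
    have "infdist x U \<le> infdist y U + dist x y" by (rule infdist_triangle)
    moreover have "infdist y U \<le> hausdist T U"
      using hausdist_infdist_le[of T U y] y STU
      by (auto simp: nonempty_compacts_def compact_imp_bounded)
    moreover have "dist x y \<le> hausdist S T"
      using hausdist_infdist_le[of S T x] y x STU
      by (auto simp: nonempty_compacts_def compact_imp_bounded)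
    ultimately show ?thesis by linarith
  qed
  show "hausdist S U \<le> hausdist S T + hausdist T U"
  proof (rule hausdist_leI)
    show "infdist y S \<le> hausdist S T + hausdist T U" if "y \<in> U" for y
      using half[OF that U T S] by (simp add: hausdist_commute)
  qed (auto simp: hausdist_nonneg intro: half S T U)
qed

definition hausdorff_topology :: "'a::metric_space set topology" where
  "hausdorff_topology = Metric_space.mtopology nonempty_compacts hausdist"

lemma topspace_hausdorff_topology [simp]:
  "topspace (hausdorff_topology :: 'a::heine_borel set topology) = nonempty_compacts"
  unfolding hausdorff_topology_def
  by (rule Metric_space.topspace_mtopology[OF Metric_space_hausdist])

text \<open>Continuity of set-valued maps: upper and lower semicontinuity.\<close>

definition set_valued_continuous ::
    "'a topology \<Rightarrow> 'b topology \<Rightarrow> ('a \<Rightarrow> 'b set) \<Rightarrow> bool" where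
  "set_valued_continuous X Y F \<longleftrightarrow>
     (\<forall>x\<in>topspace X. F x \<subseteq> topspace Y) \<and>
     (\<forall>U. openin Y U \<longrightarrow> openin X {x \<in> topspace X. F x \<subseteq> U}) \<and>
     (\<forall>U. openin Y U \<longrightarrow> openin X {x \<in> topspace X. F x \<inter> U \<noteq> {}})"


section \<open>Bi-Lipschitz images of convex sets\<close>

definition bilipschitz :: "('a::metric_space \<Rightarrow> 'a) \<Rightarrow> bool" where
  "bilipschitz \<phi> \<longleftrightarrow>
     bij \<phi> \<and> (\<exists>L. L-lipschitz_on UNIV \<phi>) \<and> (\<exists>L. L-lipschitz_on UNIV (inv \<phi>))"

definition lipeo_convex_sets :: "'a::euclidean_space set set" where
  "lipeo_convex_sets =
     {S \<in> nonempty_compacts. \<exists>\<phi>. bilipschitz \<phi> \<and> convex (\<phi> ` S)}"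

text \<open>A Lipschitz curve is differentiable almost everywhere, so the unspecified value of
  \<^const>\<open>vector_derivative\<close> at the other points does not affect the length.\<close>

definition curve_length :: "(real \<Rightarrow> 'a::euclidean_space) \<Rightarrow> real" where
  "curve_length \<psi> = integral {0..1} (\<lambda>s. norm (vector_derivative \<psi> (at s within {0..1})))"

definition intrinsic_dist :: "'a::euclidean_space set \<Rightarrow> 'a \<Rightarrow> 'a \<Rightarrow> real" where
  "intrinsic_dist S x y =
     Inf {curve_length \<psi> | \<psi>. (\<exists>L. L-lipschitz_on {0..1} \<psi>) \<and>
            \<psi> ` {0..1} \<subseteq> S \<and> \<psi> 0 = x \<and> \<psi> 1 = y}"

definition intrinsic_setdist ::
    "'a::euclidean_space set \<Rightarrow> 'a set \<Rightarrow> 'a set \<Rightarrow> real" where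
  "intrinsic_setdist S A B = (INF (x, y)\<in>A \<times> B. intrinsic_dist S x y)"

text \<open>The supremum is a maximum for the sets in \<^const>\<open>lipeo_convex_sets\<close>, since
  these are compact and their intrinsic distance is equivalent to the Euclidean one.\<close>

definition intrinsic_diameter :: "'a::euclidean_space set \<Rightarrow> real" where
  "intrinsic_diameter S = (SUP (x, y)\<in>S \<times> S. intrinsic_dist S x y)"

text \<open>The result does not depend on which \<open>\<phi>\<close> is chosen. The library's
  \<^const>\<open>rel_interior\<close> of a singleton is the singleton itself; here it is empty.\<close>

definition ri :: "'a::euclidean_space set \<Rightarrow> 'a set" where
  "ri S = (if is_singleton S then {}
     else let \<phi> = (SOME \<phi>. bilipschitz \<phi> \<and> convex (\<phi> ` S))
          in \<phi> -` rel_interior (\<phi> ` S))"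

definition rbd :: "'a::euclidean_space set \<Rightarrow> 'a set" where
  "rbd S = S - ri S"


section \<open>Directed graphs with delays\<close>

definition nodes :: "nat \<Rightarrow> nat set" where
  "nodes n = {1..n}"

definition delays :: "nat \<Rightarrow> nat set" where
  "delays h = {0..<h}"

definition delay_graph :: "nat \<Rightarrow> nat \<Rightarrow> ((nat \<times> nat) \<times> nat) set \<Rightarrow> bool" where
  "delay_graph n h A \<longleftrightarrow>
     A \<subseteq> (nodes n \<times> delays h) \<times> nodes n \<and> (\<forall>k\<in>nodes n. ((k, 0), k) \<notin> A)"

definition node_connected :: "((nat \<times> nat) \<times> nat) set \<Rightarrow> nat \<Rightarrow> nat \<Rightarrow> bool" where
  "node_connected A k l \<longleftrightarrow> (k, l) \<in> {(i, m). \<exists>j. ((i, j), m) \<in> A}\<^sup>*"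

definition connected_across ::
    "(nat \<Rightarrow> ((nat \<times> nat) \<times> nat) set) \<Rightarrow> nat set \<Rightarrow> nat \<Rightarrow> nat \<Rightarrow> bool" where
  "connected_across A I k l \<longleftrightarrow> node_connected (\<Union>t\<in>I. A t) k l"


section \<open>The state space and the multi-agent system\<close>

text \<open>A state assigns to \<open>(k, j)\<close> the component \<open>x\<^sub>k\<^sub>,\<^sub>j\<close>; functions are extensional, i.e.\ fixed
  to \<^const>\<open>undefined\<close> off the index set, so that states are exactly \<open>hn\<close>-tuples.\<close>

definition state_topology ::
    "nat \<Rightarrow> nat \<Rightarrow> (nat \<times> nat \<Rightarrow> 'a::euclidean_space) topology" where
  "state_topology n h = product_topology (\<lambda>_. euclidean) (nodes n \<times> delays h)"

definition states :: "nat \<Rightarrow> nat \<Rightarrow> (nat \<times> nat \<Rightarrow> 'a::euclidean_space) set" where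
  "states n h = nodes n \<times> delays h \<rightarrow>\<^sub>E UNIV"

definition state_dist ::
    "nat \<Rightarrow> nat \<Rightarrow> (nat \<times> nat \<Rightarrow> 'a::euclidean_space) \<Rightarrow> (nat \<times> nat \<Rightarrow> 'a) \<Rightarrow> real" where
  "state_dist n h x y = L2_set (\<lambda>p. norm (x p - y p)) (nodes n \<times> delays h)"

definition neighbour_values ::
    "((nat \<times> nat) \<times> nat) set \<Rightarrow> nat \<Rightarrow> (nat \<times> nat \<Rightarrow> 'a) \<Rightarrow> 'a set" where
  "neighbour_values A k x = {x (i, j) | i j. ((i, j), k) \<in> A}"

definition system_map ::
    "nat \<Rightarrow> nat \<Rightarrow>
     (nat \<Rightarrow> ((nat \<times> nat) \<times> nat) set \<Rightarrow> (nat \<times> nat \<Rightarrow> 'a) \<Rightarrow> 'a set) \<Rightarrow>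
     ((nat \<times> nat) \<times> nat) set \<Rightarrow>
     (nat \<times> nat \<Rightarrow> 'a::euclidean_space) \<Rightarrow> (nat \<times> nat \<Rightarrow> 'a) set" where
  "system_map n h e A x =
     {y \<in> states n h. \<forall>k\<in>nodes n.
        y (k, 0) \<in> e k A x \<and> (\<forall>j. 1 \<le> j \<and> j \<le> h - 1 \<longrightarrow> y (k, j) = x (k, j - 1))}"

definition equilibria :: "nat \<Rightarrow> nat \<Rightarrow> (nat \<times> nat \<Rightarrow> 'a::euclidean_space) set" where
  "equilibria n h = {x \<in> states n h. \<exists>c. \<forall>p\<in>nodes n \<times> delays h. x p = c}"


section \<open>Difference inclusions\<close>

definition inclusion_solution ::
    "'s set \<Rightarrow> (nat \<Rightarrow> 's \<Rightarrow> 's set) \<Rightarrow> nat \<Rightarrow> (nat \<Rightarrow> 's) \<Rightarrow> bool" where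
  "inclusion_solution X E t0 \<zeta> \<longleftrightarrow>
     (\<forall>t\<ge>t0. \<zeta> t \<in> X) \<and> (\<forall>t\<ge>t0. \<zeta> (t + 1) \<in> E t (\<zeta> t))"

definition uniformly_globally_attractive ::
    "'s set \<Rightarrow> ('s \<Rightarrow> 's \<Rightarrow> real) \<Rightarrow> (nat \<Rightarrow> 's \<Rightarrow> 's set) \<Rightarrow> 's set \<Rightarrow> bool" where
  "uniformly_globally_attractive X d E \<Phi> \<longleftrightarrow>
     (\<forall>\<phi>1\<in>\<Phi>. \<forall>c1>0. \<forall>c2>0. \<exists>T::nat. \<forall>t0 \<zeta>.
        inclusion_solution X E t0 \<zeta> \<longrightarrow> d (\<zeta> t0) \<phi>1 < c1 \<longrightarrow>
        (\<exists>\<phi>2\<in>\<Phi>. \<forall>t\<ge>t0 + T. d (\<zeta> t) \<phi>2 < c2))"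

end

theory Submission
  imports Defs
begin

text \<open>
  The hull \<open>\<sigma>(values)\<close> of all current and remembered values of the agents serves
  as a set-valued Lyapunov function. By monotonicity and idempotence it never grows.

  The heart of the matter is that it shrinks strictly over a block of fixed length whenever the
  values are not all equal (\<open>hull_strictly_decreases\<close>). Among sufficiently many connectivity
  windows one node \<open>k\<close> is a root at least \<open>n\<close> times. Let \<open>x\<close> be its value at the start of the block,
  and take a face-like subset \<open>\<Sigma>\<close> of the hull that avoids \<open>x\<close>. A value outside \<open>\<Sigma>\<close> can only produce
  values outside \<open>\<Sigma>\<close>, because an update that lands in \<open>\<Sigma>\<close> has all its arguments in \<open>\<Sigma>\<close>. Each time
  \<open>k\<close> is the root at least one more node leaves \<open>\<Sigma>\<close>, so at the end of the block no value is in
  \<open>\<Sigma>\<close>. If the hull \<open>C\<close> were the same at the end, then \<open>C\<close> would also be the hull of the final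
  values together with \<open>x\<close>, and the face condition for this set would provide a \<open>\<Sigma>\<close> that avoids \<open>x\<close>
  and contains one of the final values: a contradiction.

  Compactness makes this quantitative. Only finitely many words of graphs fit into a block and the
  one-step relation has a closed graph, so the Hausdorff drop is bounded below while the values
  are spread out (\<open>hull_drop_uniform\<close>). A decreasing sequence of subsets of a compact set can make
  only boundedly many drops of a given size (\<open>decreasing_compacts_small_drop\<close>), so within a bounded
  time the values are close together. Then their hull is small, and it confines the whole future.

  Conversely, if no node reaches all others during a long window, then two disjoint sets of nodes
  receive no information from outside (\<open>no_root_disjoint_ancestor_closed\<close>). Two different values,
  one on each set, persist throughout the window and prevent uniform convergence.
\<close>

section \<open>Hausdorff convergence and compactness\<close>

lemma finite_in_nonempty_compacts:
  "finite S \<Longrightarrow> S \<noteq> {} \<Longrightarrow> S \<in> nonempty_compacts"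
  by (simp add: nonempty_compacts_def finite_imp_compact)

lemma hausdist_eq_0_iff:
  fixes S T :: "'a::heine_borel set"
  assumes "S \<in> nonempty_compacts" "T \<in> nonempty_compacts"
  shows "hausdist S T = 0 \<longleftrightarrow> S = T"
  using Metric_space.zero[OF Metric_space_hausdist assms] .

lemma hausdist_triangle:
  fixes S T U :: "'a::heine_borel set"
  assumes "S \<in> nonempty_compacts" "T \<in> nonempty_compacts" "U \<in> nonempty_compacts"
  shows "hausdist S U \<le> hausdist S T + hausdist T U"
  using Metric_space.triangle[OF Metric_space_hausdist assms] .

lemma hausdist_image_le:
  assumes "0 \<le> r" "\<And>i. i \<in> I \<Longrightarrow> dist (f i) (g i) \<le> r"
  shows "hausdist (f ` I) (g ` I) \<le> r"
proof (rule hausdist_leI[OF assms(1)])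
  show "infdist x (g ` I) \<le> r" if "x \<in> f ` I" for x
    using that assms(2) by (auto intro: infdist_le2)
  show "infdist y (f ` I) \<le> r" if "y \<in> g ` I" for y
    using that assms(2) by (auto intro!: infdist_le2 simp: dist_commute)
qed

lemma hausdist_image_tendsto:
  assumes "finite I" "\<And>i. i \<in> I \<Longrightarrow> (\<lambda>m. f m i) \<longlonglongrightarrow> g i"
  shows "(\<lambda>m. hausdist (f m ` I) (g ` I)) \<longlonglongrightarrow> 0"
proof (rule tendsto_sandwich)
  show "\<forall>\<^sub>F m in sequentially. 0 \<le> hausdist (f m ` I) (g ` I)"
    by (simp add: hausdist_nonneg)
  have "hausdist (f m ` I) (g ` I) \<le> (\<Sum>i\<in>I. dist (f m i) (g i))" for m
    by (rule hausdist_image_le) (auto intro: sum_nonneg member_le_sum assms(1))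
  then show "\<forall>\<^sub>F m in sequentially. hausdist (f m ` I) (g ` I) \<le> (\<Sum>i\<in>I. dist (f m i) (g i))"
    by simp
  show "(\<lambda>m. \<Sum>i\<in>I. dist (f m i) (g i)) \<longlonglongrightarrow> 0"
    using assms(2) by (intro tendsto_null_sum) (simp add: tendsto_dist_iff[symmetric])
qed simp

lemma hausdist_tendsto_continuous:
  fixes \<sigma> :: "'a::heine_borel set \<Rightarrow> 'a set"
  assumes cont: "continuous_map hausdorff_topology hausdorff_topology \<sigma>"
    and Sm: "\<And>m. S m \<in> nonempty_compacts" and S: "S0 \<in> nonempty_compacts"
    and lim: "(\<lambda>m. hausdist (S m) S0) \<longlonglongrightarrow> 0"
  shows "(\<lambda>m. hausdist (\<sigma> (S m)) (\<sigma> S0)) \<longlonglongrightarrow> 0"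
proof -
  have "limitin hausdorff_topology S S0 sequentially"
    unfolding hausdorff_topology_def Metric_space.limitin_metric[OF Metric_space_hausdist]
    using Sm S order_tendstoD(2)[OF lim] by auto
  then have "limitin hausdorff_topology (\<sigma> \<circ> S) (\<sigma> S0) sequentially"
    by (rule continuous_map_limit[OF cont])
  then have "\<forall>\<^sub>F m in sequentially. hausdist (\<sigma> (S m)) (\<sigma> S0) < \<epsilon>" if "\<epsilon> > 0" for \<epsilon>
    using that unfolding hausdorff_topology_def Metric_space.limitin_metric[OF Metric_space_hausdist]
    by (auto elim: eventually_mono)
  then show ?thesis by (simp add: tendsto_iff hausdist_nonneg)
qed

text \<open>Each drop of size at least \<open>\<delta>\<close> leaves behind a point of the larger set that is far
  from all later sets; these points are separated, so a finite cover bounds their number.\<close>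

lemma decreasing_compacts_small_drop:
  fixes K :: "'a::metric_space set"
  assumes K: "compact K" and \<delta>: "0 < \<delta>"
  shows "\<exists>N::nat. \<forall>C. (\<forall>i. C i \<in> nonempty_compacts \<and> C i \<subseteq> K \<and> C (Suc i) \<subseteq> C i) \<longrightarrow>
           (\<exists>i\<le>N. hausdist (C i) (C (Suc i)) < \<delta>)"
proof -
  obtain Z where Z: "finite Z" "K \<subseteq> (\<Union>z\<in>Z. ball z (\<delta>/4))"
    using K \<delta> unfolding compact_eq_totally_bounded by (meson divide_pos_pos zero_less_numeral)
  have "\<exists>i\<le>card Z. hausdist (C i) (C (Suc i)) < \<delta>"
    if C: "\<And>i. C i \<in> nonempty_compacts \<and> C i \<subseteq> K \<and> C (Suc i) \<subseteq> C i" for C :: "nat \<Rightarrow> 'a set"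
  proof (rule ccontr)
    assume "\<not> ?thesis"
    then have big: "hausdist (C i) (C (Suc i)) \<ge> \<delta>" if "i \<le> card Z" for i
      using that by force
    have "\<exists>p\<in>C i. infdist p (C (Suc i)) > \<delta>/2" if "i \<le> card Z" for i
    proof (rule ccontr)
      assume "\<not> ?thesis"
      then have le: "infdist p (C (Suc i)) \<le> \<delta>/2" if "p \<in> C i" for p
        using that by force
      have "infdist p (C i) \<le> \<delta>/2" if "p \<in> C (Suc i)" for p
        using C[of i] that \<delta> by (simp add: subset_iff)
      then have "hausdist (C i) (C (Suc i)) \<le> \<delta>/2"
        using \<delta> le by (intro hausdist_leI) auto
      then show False using big[OF that] \<delta> by simp
    qed
    then obtain p where p: "\<And>i. i \<le> card Z \<Longrightarrow> p i \<in> C i"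
        "\<And>i. i \<le> card Z \<Longrightarrow> infdist (p i) (C (Suc i)) > \<delta>/2"
      by metis
    have "\<exists>z\<in>Z. dist z (p i) < \<delta>/4" if "i \<le> card Z" for i
      using p(1)[OF that] C[of i] Z(2) by (force simp: subset_iff)
    then obtain c where c: "\<And>i. i \<le> card Z \<Longrightarrow> c i \<in> Z \<and> dist (c i) (p i) < \<delta>/4"
      by metis
    have anti: "C j \<subseteq> C i" if "i \<le> j" for i j
      using lift_Suc_antimono_le[of C i j] C that by blast
    have neq: "c i \<noteq> c j" if "i < j" "j \<le> card Z" for i j
    proof
      assume eq: "c i = c j"
      have "p j \<in> C (Suc i)" using p(1)[of j] anti[of "Suc i" j] that by auto
      then have "infdist (p i) (C (Suc i)) \<le> dist (p i) (p j)" by (rule infdist_le)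
      moreover have "dist (p i) (p j) \<le> dist (c i) (p i) + dist (c i) (p j)"
        by (metis dist_commute dist_triangle)
      ultimately show False using p(2)[of i] c[of i] c[of j] that eq by simp
    qed
    have "inj_on c {..card Z}"
      by (rule linorder_inj_onI) (use neq in auto)
    then have "card {..card Z} \<le> card Z"
      using card_inj_on_le[of c "{..card Z}" Z] c Z(1) by auto
    then show False by simp
  qed
  then show ?thesis by blast
qed

lemma constant_subsequence:
  fixes f :: "nat \<Rightarrow> 'b"
  assumes "finite (range f)"
  obtains r c where "strict_mono (r :: nat \<Rightarrow> nat)" "\<forall>m. f (r m) = c"
proof -
  obtain a where "infinite {m. f m = f a}"
    using pigeonhole_infinite[of UNIV f] assms by auto
  then obtain r :: "nat \<Rightarrow> nat" where "strict_mono r" "\<forall>m. r m \<in> {m. f m = f a}"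
    using infinite_enumerate by metis
  then show thesis using that by blast
qed

lemma finitely_many_coordinates_subsequence:
  fixes f :: "nat \<Rightarrow> 'i \<Rightarrow> 'a::metric_space"
  assumes "finite I" "compact K" "\<And>m i. i \<in> I \<Longrightarrow> f m i \<in> K"
  shows "\<exists>r g. strict_mono (r :: nat \<Rightarrow> nat) \<and> (\<forall>i\<in>I. (\<lambda>m. f (r m) i) \<longlonglongrightarrow> g i)"
  using assms(1,3)
proof (induction I)
  case empty
  show ?case using strict_mono_id by auto
next
  case (insert i I)
  then obtain r g where r: "strict_mono (r :: nat \<Rightarrow> nat)" "\<forall>j\<in>I. (\<lambda>m. f (r m) j) \<longlonglongrightarrow> g j"
    by auto
  obtain l s where s: "strict_mono (s :: nat \<Rightarrow> nat)" "((\<lambda>m. f (r m) i) \<circ> s) \<longlonglongrightarrow> l"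
    using \<open>compact K\<close> insert.prems unfolding compact_def by (metis insertI1)
  have "(\<lambda>m. f ((r \<circ> s) m) j) \<longlonglongrightarrow> (g(i := l)) j" if "j \<in> insert i I" for j
  proof (cases "j = i")
    case True
    then show ?thesis using s(2) by (simp add: o_def)
  next
    case False
    then have "(\<lambda>m. f (r m) j) \<longlonglongrightarrow> g j" using r(2) that by auto
    from LIMSEQ_subseq_LIMSEQ[OF this s(1)] show ?thesis using False by (simp add: o_def)
  qed
  then show ?case using strict_mono_o[OF r(1) s(1)] by blast
qed


section \<open>Directed graphs\<close>

lemma rtrancl_leaves_set:
  assumes "(k, l) \<in> R\<^sup>*" "k \<in> P" "l \<notin> P"
  shows "\<exists>i m. (i, m) \<in> R \<and> i \<in> P \<and> m \<notin> P"
  using assms by (induction rule: rtrancl_induct) auto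

text \<open>A vertex with the fewest ancestors is an ancestor of each of its ancestors. If it does
  not reach some \<open>m\<close>, then it has no common ancestor with \<open>m\<close>.\<close>

lemma no_root_disjoint_ancestor_closed:
  assumes V: "finite V" "V \<noteq> {}" and R: "R \<subseteq> V \<times> V"
    and no_root: "\<And>k. k \<in> V \<Longrightarrow> \<exists>l\<in>V. (k, l) \<notin> R\<^sup>*"
  obtains P Q where "P \<subseteq> V" "Q \<subseteq> V" "P \<noteq> {}" "Q \<noteq> {}" "P \<inter> Q = {}"
    "R\<inverse> `` P \<subseteq> P" "R\<inverse> `` Q \<subseteq> Q"
proof -
  define anc where "anc l = {k \<in> V. (k, l) \<in> R\<^sup>*}" for l
  have fin: "finite (anc l)" for l using V(1) by (simp add: anc_def)
  obtain k where k: "k \<in> V" "\<And>l. l \<in> V \<Longrightarrow> card (anc k) \<le> card (anc l)"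
    using arg_min_if_finite[of V "\<lambda>l. card (anc l)"] V by (metis not_le)
  obtain m where m: "m \<in> V" "(k, m) \<notin> R\<^sup>*" using no_root k(1) by blast
  have reach: "(k, i) \<in> R\<^sup>*" if "i \<in> anc k" for i
  proof -
    have "anc i \<subseteq> anc k" using that by (auto simp: anc_def)
    then have "anc i = anc k"
      using k(2)[of i] that card_seteq[OF fin] by (auto simp: anc_def)
    then show ?thesis using k(1) by (auto simp: anc_def)
  qed
  show thesis
  proof (rule that[of "anc k" "anc m"])
    show "anc k \<inter> anc m = {}"
      using reach m(2) by (auto simp: anc_def dest: rtrancl_trans)
    show "R\<inverse> `` anc k \<subseteq> anc k" "R\<inverse> `` anc m \<subseteq> anc m"
      using R by (auto simp: anc_def intro: converse_rtrancl_into_rtrancl)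
  qed (use k m in \<open>auto simp: anc_def\<close>)
qed

lemma pigeonhole_frequent_value:
  assumes "finite V" "V \<noteq> {}" "\<And>i. i < card V * b \<Longrightarrow> f i \<in> V"
  shows "\<exists>k\<in>V. b \<le> card {i. i < card V * b \<and> f i = k}"
proof (rule ccontr)
  assume "\<not> ?thesis"
  then have less: "card {i. i < card V * b \<and> f i = k} < b" if "k \<in> V" for k
    using that by force
  have "{..<card V * b} = (\<Union>k\<in>V. {i. i < card V * b \<and> f i = k})"
    using assms(3) by auto
  then have "card V * b \<le> (\<Sum>k\<in>V. card {i. i < card V * b \<and> f i = k})"
    using card_UN_le[OF assms(1), of "\<lambda>k. {i. i < card V * b \<and> f i = k}"]
    by (metis card_lessThan)
  also have "\<dots> < (\<Sum>k\<in>V. b)"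
    using assms(1,2) less by (intro sum_strict_mono) auto
  finally show False by simp
qed

section \<open>Set-valued maps on the state space\<close>

lemma set_valued_continuous_closed_graph:
  fixes F :: "'b \<Rightarrow> 'a::metric_space set"
  assumes F: "set_valued_continuous X euclidean F"
    and x: "limitin X x x0 sequentially" and closed: "closed (F x0)"
    and y: "y \<longlonglongrightarrow> y0" and mem: "\<And>m. y m \<in> F (x m)"
  shows "y0 \<in> F x0"
proof (rule ccontr)
  assume "y0 \<notin> F x0"
  then obtain r where r: "r > 0" "ball y0 r \<inter> F x0 = {}"
    using openE[of "- F x0" y0] closed by (metis ComplI disjoint_eq_subset_Compl open_Compl)
  let ?U = "- cball y0 (r/2)"
  have "openin X {x \<in> topspace X. F x \<subseteq> ?U}"
    using F by (auto simp: set_valued_continuous_def open_Compl)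
  moreover have "x0 \<in> {x \<in> topspace X. F x \<subseteq> ?U}"
    using r x limitin_topspace[OF x] by (auto simp: disjoint_iff)
  ultimately have "\<forall>\<^sub>F m in sequentially. x m \<in> {x \<in> topspace X. F x \<subseteq> ?U}"
    using x unfolding limitin_def by blast
  moreover have "\<forall>\<^sub>F m in sequentially. dist (y m) y0 < r/2"
    using r(1) by (intro tendstoD[OF y]) simp
  ultimately have "\<forall>\<^sub>F m in sequentially. False"
  proof eventually_elim
    case (elim m)
    then have "y m \<notin> cball y0 (r/2)" using mem[of m] by blast
    then show False using elim(2) by (simp add: dist_commute)
  qed
  then show False by simp
qed

lemma finite_nodes_delays: "finite (nodes n \<times> delays h)"
  by (simp add: nodes_def delays_def)

lemma limitin_state_topology:
  assumes "\<And>m. x m \<in> states n h" "x0 \<in> states n h"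
    and "\<And>p. p \<in> nodes n \<times> delays h \<Longrightarrow> (\<lambda>m. x m p) \<longlonglongrightarrow> x0 p"
  shows "limitin (state_topology n h) x x0 sequentially"
  unfolding state_topology_def limitin_componentwise
  using assms by (auto simp: states_def PiE_def extensional_def)

lemma state_dist_lessI:
  assumes "c > 0" "\<And>p. p \<in> nodes n \<times> delays h \<Longrightarrow> norm (x p - y p) \<le> r"
    and "real (card (nodes n \<times> delays h)) * r < c"
  shows "state_dist n h x y < c"
proof -
  have "state_dist n h x y \<le> (\<Sum>p\<in>nodes n \<times> delays h. norm (x p - y p))"
    unfolding state_dist_def by (rule L2_set_le_sum) simp
  also have "\<dots> \<le> real (card (nodes n \<times> delays h)) * r"
    using sum_bounded_above[of "nodes n \<times> delays h" "\<lambda>p. norm (x p - y p)" r] assms(2) by auto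
  finally show ?thesis using assms(3) by simp
qed

lemma norm_component_le_state_dist:
  assumes "p \<in> nodes n \<times> delays h"
  shows "norm (x p - y p) \<le> state_dist n h x y"
  unfolding state_dist_def
  using member_le_L2_set[OF finite_nodes_delays assms, of "\<lambda>p. norm (x p - y p)"] by simp

lemma neighbour_values_subset:
  assumes "delay_graph n h A"
  shows "neighbour_values A k x \<subseteq> x ` (nodes n \<times> delays h)"
  using assms by (force simp: neighbour_values_def delay_graph_def)

section \<open>Hull operators and multi-agent systems\<close>

text \<open>A set that behaves like a union of faces of \<open>C\<close>: it meets the relative interior of a hull
  only if it contains the points that span this hull.\<close>

definition face_like :: "('a::euclidean_space set \<Rightarrow> 'a set) \<Rightarrow> 'a set \<Rightarrow> 'a set \<Rightarrow> bool" where
  "face_like \<sigma> C \<Sigma> \<longleftrightarrow>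
     (\<forall>S'\<in>nonempty_compacts. S' \<subseteq> C \<longrightarrow> ri (\<sigma> S') \<inter> \<Sigma> \<noteq> {} \<longrightarrow> S' \<subseteq> \<Sigma>)"

locale hull_system =
  fixes \<sigma> :: "'a::euclidean_space set \<Rightarrow> 'a set"
    and e :: "nat \<Rightarrow> ((nat \<times> nat) \<times> nat) set \<Rightarrow> (nat \<times> nat \<Rightarrow> 'a) \<Rightarrow> 'a set"
    and n h :: nat
  assumes n: "n \<ge> 1" and h: "h \<ge> 1"
    and hull_sets: "\<sigma> ` nonempty_compacts \<subseteq> lipeo_convex_sets"
    and hull_cont: "continuous_map hausdorff_topology hausdorff_topology \<sigma>"
    and hull_extensive: "\<And>S. S \<in> nonempty_compacts \<Longrightarrow> S \<subseteq> \<sigma> S"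
    and hull_singleton: "\<And>S. S \<in> nonempty_compacts \<Longrightarrow> is_singleton S \<Longrightarrow> \<sigma> S = S"
    and hull_idem: "\<And>S. S \<in> nonempty_compacts \<Longrightarrow> \<sigma> (\<sigma> S) = \<sigma> S"
    and hull_mono: "\<And>S S'. S \<in> nonempty_compacts \<Longrightarrow> S' \<in> nonempty_compacts \<Longrightarrow> S' \<subseteq> S \<Longrightarrow> \<sigma> S' \<subseteq> \<sigma> S"
    and hull_face: "\<And>S x. S \<in> nonempty_compacts \<Longrightarrow> \<not> is_singleton S \<Longrightarrow> x \<in> S \<Longrightarrow>
               \<exists>\<Sigma>. face_like \<sigma> (\<sigma> S) \<Sigma> \<and> \<Sigma> \<inter> S \<noteq> {} \<and> x \<notin> \<Sigma>"
    and update_cont: "\<And>k A. k \<in> nodes n \<Longrightarrow> delay_graph n h A \<Longrightarrow>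
               set_valued_continuous (state_topology n h) euclidean (e k A)"
    and update_compact: "\<And>k A x. k \<in> nodes n \<Longrightarrow> delay_graph n h A \<Longrightarrow> x \<in> states n h \<Longrightarrow>
               e k A x \<in> nonempty_compacts"
    and update_agreement: "\<And>k A x. k \<in> nodes n \<Longrightarrow> delay_graph n h A \<Longrightarrow> x \<in> states n h \<Longrightarrow>
               neighbour_values A k x \<subseteq> {x (k, 0)} \<Longrightarrow> e k A x = {x (k, 0)}"
    and update_ri: "\<And>k A x. k \<in> nodes n \<Longrightarrow> delay_graph n h A \<Longrightarrow> x \<in> states n h \<Longrightarrow>
               \<not> neighbour_values A k x \<subseteq> {x (k, 0)} \<Longrightarrow>
               e k A x \<subset> ri (\<sigma> ({x (k, 0)} \<union> neighbour_values A k x))"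
begin

abbreviation components :: "(nat \<times> nat) set" where
  "components \<equiv> nodes n \<times> delays h"

abbreviation vals :: "(nat \<times> nat \<Rightarrow> 'a) \<Rightarrow> 'a set" where
  "vals x \<equiv> x ` components"

lemma component_0: "k \<in> nodes n \<Longrightarrow> (k, 0) \<in> components"
  using h by (simp add: delays_def)

lemma first_component: "(1, 0) \<in> components"
  using n by (intro component_0) (simp add: nodes_def)

lemma vals_compact: "vals x \<in> nonempty_compacts"
  using first_component by (intro finite_in_nonempty_compacts) (auto simp: finite_nodes_delays)

lemma hull_compact: "S \<in> nonempty_compacts \<Longrightarrow> \<sigma> S \<in> nonempty_compacts"
  using hull_sets by (auto simp: lipeo_convex_sets_def)

lemma hull_least:
  assumes "S \<in> nonempty_compacts" "S' \<in> nonempty_compacts" "S' \<subseteq> \<sigma> S"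
  shows "\<sigma> S' \<subseteq> \<sigma> S"
  using hull_mono[OF hull_compact[OF assms(1)] assms(2,3)] hull_idem[OF assms(1)] by simp

lemma ri_hull_subset:
  assumes "S \<in> nonempty_compacts"
  shows "ri (\<sigma> S) \<subseteq> \<sigma> S"
proof (cases "is_singleton (\<sigma> S)")
  case True
  then show ?thesis by (simp add: ri_def)
next
  case False
  define \<phi> where "\<phi> = (SOME \<phi>. bilipschitz \<phi> \<and> convex (\<phi> ` \<sigma> S))"
  have "\<exists>\<phi>. bilipschitz \<phi> \<and> convex (\<phi> ` \<sigma> S)"
    using hull_sets assms by (auto simp: lipeo_convex_sets_def)
  then have "bilipschitz \<phi>" unfolding \<phi>_def by (rule someI2_ex) simp
  then have "inj \<phi>" by (simp add: bilipschitz_def bij_is_inj)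
  have "ri (\<sigma> S) = \<phi> -` rel_interior (\<phi> ` \<sigma> S)"
    using False by (simp add: ri_def \<phi>_def Let_def)
  also have "\<dots> \<subseteq> \<phi> -` (\<phi> ` \<sigma> S)" using rel_interior_subset by blast
  also have "\<dots> = \<sigma> S" using \<open>inj \<phi>\<close> by (simp add: inj_vimage_image_eq)
  finally show ?thesis .
qed

lemma seen_values_compact:
  assumes "delay_graph n h A" "k \<in> nodes n"
  shows "{x (k, 0)} \<union> neighbour_values A k x \<in> nonempty_compacts"
    and "{x (k, 0)} \<union> neighbour_values A k x \<subseteq> vals x"
proof -
  show sub: "{x (k, 0)} \<union> neighbour_values A k x \<subseteq> vals x"
    using neighbour_values_subset[OF assms(1)] imageI[OF component_0[OF assms(2)], of x] by simp
  have "finite (vals x)" by (simp add: finite_nodes_delays)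
  then show "{x (k, 0)} \<union> neighbour_values A k x \<in> nonempty_compacts"
    using finite_subset[OF sub] by (intro finite_in_nonempty_compacts) auto
qed

lemma system_map_vals:
  assumes A: "delay_graph n h A" and x: "x \<in> states n h" and y: "y \<in> system_map n h e A x"
  shows "vals y \<subseteq> \<sigma> (vals x)"
proof clarify
  fix k j assume kj: "k \<in> nodes n" "j \<in> delays h"
  show "y (k, j) \<in> \<sigma> (vals x)"
  proof (cases j)
    case 0
    let ?S = "{x (k, 0)} \<union> neighbour_values A k x"
    have "e k A x \<subseteq> \<sigma> ?S"
    proof (cases "neighbour_values A k x \<subseteq> {x (k, 0)}")
      case True
      then show ?thesis
        using update_agreement[OF kj(1) A x True] hull_extensive[OF seen_values_compact(1)[OF A kj(1)]]
        by simp
    next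
      case False
      then show ?thesis
        using update_ri[OF kj(1) A x False] ri_hull_subset[OF seen_values_compact(1)[OF A kj(1), of x]]
        by (meson order_trans psubset_imp_subset)
    qed
    also have "\<dots> \<subseteq> \<sigma> (vals x)"
      by (rule hull_mono[OF vals_compact seen_values_compact[OF A kj(1)]])
    finally show ?thesis using y kj(1) 0 by (auto simp: system_map_def)
  next
    case (Suc i)
    then have "y (k, j) = x (k, i)" "(k, i) \<in> components"
      using y kj by (auto simp: system_map_def delays_def)
    then show ?thesis using hull_extensive[OF vals_compact] by auto
  qed
qed

lemma system_map_nonempty:
  assumes A: "delay_graph n h A" and x: "x \<in> states n h"
  shows "\<exists>y. y \<in> system_map n h e A x"
proof -
  let ?y = "restrict (\<lambda>(k, j). if j = 0 then SOME v. v \<in> e k A x else x (k, j - 1)) components"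
  have "(SOME v. v \<in> e k A x) \<in> e k A x" if "k \<in> nodes n" for k
    using update_compact[OF that A x] by (simp add: nonempty_compacts_def some_in_eq)
  then have "?y \<in> system_map n h e A x"
    using h by (auto simp: system_map_def states_def delays_def)
  then show ?thesis by blast
qed

text \<open>The one-step relation has a closed graph, so limits of trajectories are trajectories.\<close>

lemma system_map_closed_graph:
  assumes A: "delay_graph n h A"
    and x: "\<And>m. x m \<in> states n h" "x0 \<in> states n h"
      "\<And>p. p \<in> components \<Longrightarrow> (\<lambda>m. x m p) \<longlonglongrightarrow> x0 p"
    and y: "y0 \<in> states n h" "\<And>p. p \<in> components \<Longrightarrow> (\<lambda>m. y m p) \<longlonglongrightarrow> y0 p"
    and step: "\<And>m. y m \<in> system_map n h e A (x m)"
  shows "y0 \<in> system_map n h e A x0"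
  unfolding system_map_def
proof (intro CollectI conjI ballI allI impI)
  show "y0 \<in> states n h" by fact
  fix k assume k: "k \<in> nodes n"
  show "y0 (k, 0) \<in> e k A x0"
  proof (rule set_valued_continuous_closed_graph[OF update_cont[OF k A]])
    show "limitin (state_topology n h) x x0 sequentially"
      using x by (rule limitin_state_topology)
    show "closed (e k A x0)"
      using update_compact[OF k A x(2)] by (simp add: nonempty_compacts_def compact_imp_closed)
    show "(\<lambda>m. y m (k, 0)) \<longlonglongrightarrow> y0 (k, 0)" by (rule y(2)[OF component_0[OF k]])
    show "y m (k, 0) \<in> e k A (x m)" for m using step[of m] k by (simp add: system_map_def)
  qed
  fix j assume j: "1 \<le> j \<and> j \<le> h - 1"
  then have "(k, j) \<in> components" "(k, j - 1) \<in> components"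
    using k by (auto simp: delays_def)
  then have "(\<lambda>m. y m (k, j)) \<longlonglongrightarrow> y0 (k, j)" "(\<lambda>m. x m (k, j - 1)) \<longlonglongrightarrow> x0 (k, j - 1)"
    using x(3) y(2) by auto
  moreover have "y m (k, j) = x m (k, j - 1)" for m
    using step[of m] k j by (simp add: system_map_def)
  ultimately show "y0 (k, j) = x0 (k, j - 1)" using LIMSEQ_unique by auto
qed

definition segment ::
    "(nat \<Rightarrow> ((nat \<times> nat) \<times> nat) set) \<Rightarrow> nat \<Rightarrow> (nat \<Rightarrow> nat \<times> nat \<Rightarrow> 'a) \<Rightarrow> bool" where
  "segment B L z \<longleftrightarrow>
     (\<forall>s\<le>L. z s \<in> states n h) \<and> (\<forall>s<L. z (Suc s) \<in> system_map n h e (B s) (z s))"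

lemma segment_of_solution:
  assumes "inclusion_solution (states n h) (\<lambda>t. system_map n h e (A t)) t0 \<zeta>" "t0 \<le> t"
  shows "segment (\<lambda>s. A (t + s)) L (\<lambda>s. \<zeta> (t + s))"
  using assms by (simp add: segment_def inclusion_solution_def)

lemma segment_hull_decreasing:
  assumes B: "\<And>s. delay_graph n h (B s)" and z: "segment B L z" and s: "s \<le> s'" "s' \<le> L"
  shows "\<sigma> (vals (z s')) \<subseteq> \<sigma> (vals (z s))"
  using s
proof (induction rule: dec_induct)
  case base
  show ?case by simp
next
  case (step m)
  have "vals (z (Suc m)) \<subseteq> \<sigma> (vals (z m))"
    by (rule system_map_vals[OF B[of m]]) (use z step in \<open>auto simp: segment_def\<close>)
  then have "\<sigma> (vals (z (Suc m))) \<subseteq> \<sigma> (vals (z m))" by (rule hull_least[OF vals_compact vals_compact])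
  then show ?case using step by auto
qed


section \<open>Leaving a face-like set\<close>

text \<open>A new value in the relative interior of a hull lies in a face-like set only if all the
  values that span the hull do.\<close>

lemma update_avoids_face:
  assumes A: "delay_graph n h A" and x: "x \<in> states n h" "vals x \<subseteq> C"
    and y: "y \<in> system_map n h e A x" and face: "face_like \<sigma> C \<Sigma>" and k: "k \<in> nodes n"
    and outside: "v \<in> {x (k, 0)} \<union> neighbour_values A k x" "v \<notin> \<Sigma>"
  shows "y (k, 0) \<notin> \<Sigma>"
proof (cases "neighbour_values A k x \<subseteq> {x (k, 0)}")
  case True
  then have "v = x (k, 0)" using outside(1) by auto
  moreover have "y (k, 0) = x (k, 0)"
    using update_agreement[OF k A x(1) True] y k by (auto simp: system_map_def)
  ultimately show ?thesis using outside(2) by simp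
next
  case False
  then have "y (k, 0) \<in> ri (\<sigma> ({x (k, 0)} \<union> neighbour_values A k x))"
    using update_ri[OF k A x(1) False] y k by (auto simp: system_map_def)
  then show ?thesis
    using face seen_values_compact[OF A k, of x] x(2) outside
    unfolding face_like_def by (meson disjoint_iff order_trans subsetD)
qed

definition outside_nodes :: "'a set \<Rightarrow> (nat \<times> nat \<Rightarrow> 'a) \<Rightarrow> nat set" where
  "outside_nodes \<Sigma> x = {k \<in> nodes n. \<forall>j<h. x (k, j) \<notin> \<Sigma>}"

lemma outside_nodes_subset: "outside_nodes \<Sigma> x \<subseteq> nodes n"
  by (auto simp: outside_nodes_def)

lemma finite_nodes: "finite (nodes n)" and card_nodes: "card (nodes n) = n"
  by (simp_all add: nodes_def)

context
  fixes B L z C \<Sigma>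
  assumes B: "\<And>s. delay_graph n h (B s)" and z: "segment B L z"
    and C: "\<And>s. s \<le> L \<Longrightarrow> vals (z s) \<subseteq> C" and face: "face_like \<sigma> C \<Sigma>"
begin

lemma leaves_face:
  assumes "s < L" "k \<in> nodes n" "v \<in> {z s (k, 0)} \<union> neighbour_values (B s) k (z s)" "v \<notin> \<Sigma>"
  shows "z (Suc s) (k, 0) \<notin> \<Sigma>"
  using update_avoids_face[OF B _ _ _ face assms(2) assms(3,4)] z C assms(1)
  by (simp add: segment_def)

text \<open>A node remembers \<open>h\<close> values, so its old values in the face are forgotten after \<open>h - 1\<close>
  steps.\<close>

lemma outside_after_delay:
  assumes k: "k \<in> nodes n" "z s (k, 0) \<notin> \<Sigma>" and d: "s + d \<le> L"
  shows "\<forall>j\<le>d. j < h \<longrightarrow> z (s + d) (k, j) \<notin> \<Sigma>"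
  using d
proof (induction d)
  case 0
  show ?case using k by simp
next
  case (Suc d)
  have step: "z (Suc (s + d)) \<in> system_map n h e (B (s + d)) (z (s + d))"
    using z Suc.prems by (simp add: segment_def)
  have "z (s + Suc d) (k, j) \<notin> \<Sigma>" if j: "j \<le> Suc d" "j < h" for j
  proof (cases j)
    case 0
    then show ?thesis using leaves_face[of "s + d" k "z (s + d) (k, 0)"] Suc k(1) j by simp
  next
    case (Suc i)
    then have "z (s + Suc d) (k, j) = z (s + d) (k, i)"
      using step k(1) j by (auto simp: system_map_def)
    then show ?thesis using Suc.IH Suc.prems Suc j by simp
  qed
  then show ?case by blast
qed

lemma outside_nodes_after:
  assumes "k \<in> nodes n" "z s (k, 0) \<notin> \<Sigma>" "h \<le> Suc d" "s + d \<le> L"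
  shows "k \<in> outside_nodes \<Sigma> (z (s + d))"
  using outside_after_delay[OF assms(1,2,4)] assms(1,3) by (auto simp: outside_nodes_def)

lemma outside_nodes_increasing:
  assumes "s \<le> s'" "s' \<le> L"
  shows "outside_nodes \<Sigma> (z s) \<subseteq> outside_nodes \<Sigma> (z s')"
  using assms
proof (induction rule: dec_induct)
  case base
  show ?case by simp
next
  case (step m)
  have step_m: "z (Suc m) \<in> system_map n h e (B m) (z m)"
    using z step by (simp add: segment_def)
  have "outside_nodes \<Sigma> (z m) \<subseteq> outside_nodes \<Sigma> (z (Suc m))"
  proof
    fix k assume k: "k \<in> outside_nodes \<Sigma> (z m)"
    have "z (Suc m) (k, j) \<notin> \<Sigma>" if "j < h" for j
    proof (cases j)
      case 0
      then show ?thesis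
        using leaves_face[of m k "z m (k, 0)"] k that step by (simp add: outside_nodes_def)
    next
      case (Suc i)
      then have "z (Suc m) (k, j) = z m (k, i)"
        using step_m k that by (auto simp: system_map_def outside_nodes_def)
      then show ?thesis using k that Suc by (simp add: outside_nodes_def)
    qed
    then show "k \<in> outside_nodes \<Sigma> (z (Suc m))" using k by (simp add: outside_nodes_def)
  qed
  then show ?case using step by auto
qed

text \<open>While a root is outside the face and some node is not, an arc leads from the outside nodes
  to another node, and that node leaves.\<close>

lemma outside_nodes_grow:
  assumes root: "k \<in> outside_nodes \<Sigma> (z a)"
      "\<And>l. l \<in> nodes n \<Longrightarrow> connected_across B {a..a + T} k l"
    and not_all: "outside_nodes \<Sigma> (z a) \<noteq> nodes n" and L: "a + (T + h) \<le> L"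
  shows "card (outside_nodes \<Sigma> (z a)) < card (outside_nodes \<Sigma> (z (a + (T + h))))"
proof -
  let ?P = "outside_nodes \<Sigma> (z a)"
  obtain l where l: "l \<in> nodes n" "l \<notin> ?P" using not_all outside_nodes_subset by blast
  have "(k, l) \<in> {(i, m). \<exists>j. ((i, j), m) \<in> (\<Union>t\<in>{a..a + T}. B t)}\<^sup>*"
    using root(2)[OF l(1)] by (simp add: connected_across_def node_connected_def)
  from rtrancl_leaves_set[OF this root(1) l(2)] obtain i j m t where
    arc: "((i, j), m) \<in> B t" "a \<le> t" "t \<le> a + T" "i \<in> ?P" "m \<notin> ?P" by auto
  have nodes: "j < h" "m \<in> nodes n"
    using B[of t] arc(1) by (auto simp: delay_graph_def delays_def)
  have "t < L" using arc(3) L h by simp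
  have "i \<in> outside_nodes \<Sigma> (z t)"
    using outside_nodes_increasing[OF arc(2)] arc(4) \<open>t < L\<close> by auto
  then have "z t (i, j) \<notin> \<Sigma>" using nodes(1) by (simp add: outside_nodes_def)
  then have "z (Suc t) (m, 0) \<notin> \<Sigma>"
    using leaves_face[OF \<open>t < L\<close> nodes(2), of "z t (i, j)"] arc(1)
    by (auto simp: neighbour_values_def)
  then have "m \<in> outside_nodes \<Sigma> (z (Suc t + (a + T + h - Suc t)))"
    using L arc(3) h by (intro outside_nodes_after[OF nodes(2)]) auto
  then have "m \<in> outside_nodes \<Sigma> (z (a + (T + h)))"
    using arc(3) h by (simp add: add.assoc)
  then have "?P \<subset> outside_nodes \<Sigma> (z (a + (T + h)))"
    using outside_nodes_increasing[of a "a + (T + h)"] L arc(5) by auto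
  then show ?thesis
    using psubset_card_mono[of "outside_nodes \<Sigma> (z (a + (T + h)))"]
      finite_subset[OF outside_nodes_subset finite_nodes] by blast
qed

text \<open>The outside set is sure to grow only in windows in which the fixed node \<open>k\<close> is the root: another
  root may itself be inside the face. Hence the number of such windows is what counts. The first
  \<open>h\<close> steps make the whole memory of \<open>k\<close> outside; each window gets \<open>h\<close> extra steps for the
  memory of the node that leaves.\<close>

lemma all_nodes_leave_face:
  fixes f :: "nat \<Rightarrow> nat"
  assumes L: "L = h + W * (T + h)"
    and roots: "\<And>i l. i < W \<Longrightarrow> l \<in> nodes n \<Longrightarrow>
      connected_across B {h + i * (T + h)..h + i * (T + h) + T} (f i) l"
    and k: "k \<in> nodes n" "z 0 (k, 0) \<notin> \<Sigma>" and frequent: "n \<le> card {i. i < W \<and> f i = k}"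
  shows "vals (z L) \<inter> \<Sigma> = {}"
proof -
  let ?P = "\<lambda>i. outside_nodes \<Sigma> (z (h + i * (T + h)))"
  have k_out: "k \<in> ?P i" if "i \<le> W" for i
    using outside_nodes_after[OF k, of "h + i * (T + h)"] that L by (simp add: mult_le_mono1)
  have "?P i = nodes n \<or> card {i'. i' < i \<and> f i' = k} < card (?P i)" if "i \<le> W" for i
    using that
  proof (induction i)
    case 0
    have "card (?P 0) > 0"
      using k_out[of 0] finite_subset[OF outside_nodes_subset finite_nodes]
      by (metis card_gt_0_iff empty_iff zero_le)
    then show ?case by simp
  next
    case (Suc i)
    have le: "h + i * (T + h) + (T + h) \<le> L"
      using mult_le_mono1[OF Suc.prems, of "T + h"] L by simp
    have eq: "h + Suc i * (T + h) = h + i * (T + h) + (T + h)" by simp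
    have sub: "?P i \<subseteq> ?P (Suc i)"
      unfolding eq by (rule outside_nodes_increasing) (use le in auto)
    show ?case
    proof (cases "?P i = nodes n")
      case True
      then show ?thesis using sub outside_nodes_subset by blast
    next
      case False
      then have IH: "card {i'. i' < i \<and> f i' = k} < card (?P i)" using Suc by simp
      show ?thesis
      proof (cases "f i = k")
        case True
        have "card (?P i) < card (?P (Suc i))"
          unfolding eq
          using Suc.prems True roots[of i] k_out[of i] False le
          by (intro outside_nodes_grow[of k]) auto
        moreover have "{i'. i' < Suc i \<and> f i' = k} = insert i {i'. i' < i \<and> f i' = k}"
          using True by auto
        ultimately show ?thesis using IH by simp
      next
        case False
        then have "{i'. i' < Suc i \<and> f i' = k} = {i'. i' < i \<and> f i' = k}"
          by (auto simp: less_Suc_eq)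
        moreover have "card (?P i) \<le> card (?P (Suc i))"
          using sub by (intro card_mono finite_subset[OF outside_nodes_subset finite_nodes])
        ultimately show ?thesis using IH by simp
      qed
    qed
  qed
  from this[of W] have "?P W = nodes n"
    using frequent card_mono[OF finite_nodes outside_nodes_subset, of \<Sigma> "z (h + W * (T + h))"]
      card_nodes by auto
  then have "z L (k, j) \<notin> \<Sigma>" if "k \<in> nodes n" "j < h" for k j
    using that L unfolding outside_nodes_def by blast
  then show ?thesis by (auto simp: delays_def)
qed

end

section \<open>Strict decrease of the hull\<close>

text \<open>Suppose the hull \<open>C\<close> of the state is the same at both ends, and let \<open>x\<close> be the first value
  of a node that is a root in many windows. The set \<open>S\<close> made of \<open>x\<close> and the final values still
  spans \<open>C\<close>, so some face-like set of \<open>C\<close> meets \<open>S\<close> and avoids \<open>x\<close>. But all nodes leave any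
  face-like set that avoids \<open>x\<close>. A face-like set chosen for the initial values would not
  do, since points outside it may still span \<open>C\<close>: for the hull by axis-parallel boxes, a corner is
  face-like and the two neighbouring corners of a rectangle span the rectangle.\<close>

lemma hull_strictly_decreases:
  assumes B: "\<And>s. delay_graph n h (B s)"
    and roots: "\<And>a. \<exists>k\<in>nodes n. \<forall>l\<in>nodes n. connected_across B {a..a + T} k l"
    and L: "L = h + n * n * (T + h)" and z: "segment B L z"
    and nonconst: "\<not> is_singleton (vals (z 0))"
  shows "\<sigma> (vals (z L)) \<noteq> \<sigma> (vals (z 0))"
proof
  assume eq: "\<sigma> (vals (z L)) = \<sigma> (vals (z 0))"
  obtain f where f: "\<And>a. f a \<in> nodes n" "\<And>a l. l \<in> nodes n \<Longrightarrow> connected_across B {a..a + T} (f a) l"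
    using roots by metis
  have "nodes n \<noteq> {}" using n by (simp add: nodes_def)
  then obtain k where k: "k \<in> nodes n" "n \<le> card {i. i < n * n \<and> f (h + i * (T + h)) = k}"
    using pigeonhole_frequent_value[OF finite_nodes, of n "\<lambda>i. f (h + i * (T + h))"] f(1)
    unfolding card_nodes by blast
  define x where "x = z 0 (k, 0)"
  define S where "S = insert x (vals (z L))"
  have x: "x \<in> vals (z 0)" unfolding x_def by (rule imageI[OF component_0[OF k(1)]])
  have S: "S \<in> nonempty_compacts"
    unfolding S_def by (rule finite_in_nonempty_compacts) (simp_all add: finite_nodes_delays)
  have "S \<subseteq> \<sigma> (vals (z 0))"
    using x hull_extensive[OF vals_compact, of "z 0"] hull_extensive[OF vals_compact, of "z L"] eq
    unfolding S_def by blast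
  then have "\<sigma> S \<subseteq> \<sigma> (vals (z 0))" by (rule hull_least[OF vals_compact S])
  moreover have "\<sigma> (vals (z L)) \<subseteq> \<sigma> S"
    by (rule hull_mono[OF S vals_compact]) (auto simp: S_def)
  ultimately have hull_S: "\<sigma> S = \<sigma> (vals (z 0))" using eq by simp
  have "\<not> is_singleton S"
  proof
    assume sing: "is_singleton S"
    then have "vals (z 0) \<subseteq> S"
      using hull_singleton[OF S] hull_S hull_extensive[OF vals_compact, of "z 0"] by simp
    with sing nonconst x show False
      by (metis empty_iff is_singletonE is_singletonI subset_singletonD)
  qed
  then obtain \<Sigma> where \<Sigma>: "face_like \<sigma> (\<sigma> (vals (z 0))) \<Sigma>" "\<Sigma> \<inter> S \<noteq> {}" "x \<notin> \<Sigma>"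
    using hull_face[OF S, of x] hull_S by (auto simp: S_def)
  have "vals (z s) \<subseteq> \<sigma> (vals (z 0))" if "s \<le> L" for s
    using hull_extensive[OF vals_compact, of "z s"] segment_hull_decreasing[OF B z _ that, of 0] by auto
  then have "vals (z L) \<inter> \<Sigma> = {}"
    using all_nodes_leave_face[OF B z _ \<Sigma>(1) L, of "\<lambda>i. f (h + i * (T + h))" k]
      f(2) k \<Sigma>(3) by (simp add: x_def)
  then show False using \<Sigma>(2,3) by (auto simp: S_def)
qed

text \<open>Otherwise a sequence of segments with vanishing drops has a limit segment: only finitely
  many words of graphs of length \<open>L\<close> exist, so one of them can be kept fixed, and the states stay
  in a compact set. The hull does not drop along the limit, which contradicts the strict decrease.\<close>

lemma hull_drop_uniform:
  assumes A: "\<And>t. delay_graph n h (A t)"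
    and roots: "\<And>a. \<exists>k\<in>nodes n. \<forall>l\<in>nodes n. connected_across A {a..a + T} k l"
    and L: "L = h + n * n * (T + h)" and K: "compact K" and \<epsilon>: "\<epsilon> > 0"
  shows "\<exists>\<delta>>0. \<forall>t z. segment (\<lambda>s. A (t + s)) L z \<longrightarrow> (\<forall>s\<le>L. vals (z s) \<subseteq> K) \<longrightarrow>
           (\<exists>p\<in>components. \<epsilon> \<le> dist (z 0 (1, 0)) (z 0 p)) \<longrightarrow>
           \<delta> \<le> hausdist (\<sigma> (vals (z 0))) (\<sigma> (vals (z L)))"
proof (rule ccontr)
  assume neg: "\<not> ?thesis"
  have "\<exists>t z. segment (\<lambda>s. A (t + s)) L z \<and> (\<forall>s\<le>L. vals (z s) \<subseteq> K) \<and>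
           (\<exists>p\<in>components. \<epsilon> \<le> dist (z 0 (1, 0)) (z 0 p)) \<and>
           hausdist (\<sigma> (vals (z 0))) (\<sigma> (vals (z L))) < inverse (real (Suc m))" for m
    using neg by (metis inverse_positive_iff_positive not_le of_nat_0_less_iff zero_less_Suc)
  then obtain t z where
    seg: "\<And>m. segment (\<lambda>s. A (t m + s)) L (z m)" and
    inK: "\<And>m s. s \<le> L \<Longrightarrow> vals (z m s) \<subseteq> K" and
    spread: "\<And>m. \<exists>p\<in>components. \<epsilon> \<le> dist (z m 0 (1, 0)) (z m 0 p)" and
    drop: "\<And>m. hausdist (\<sigma> (vals (z m 0))) (\<sigma> (vals (z m L))) < inverse (real (Suc m))"
    by metis
  let ?word = "\<lambda>m. restrict (\<lambda>s. A (t m + s)) {..<L}"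
  have "A s \<subseteq> components \<times> nodes n" for s using A[of s] by (simp add: delay_graph_def)
  then have "range ?word \<subseteq> {..<L} \<rightarrow>\<^sub>E Pow (components \<times> nodes n)"
    by (intro image_subsetI restrict_PiE_iff[THEN iffD2] ballI PowI)
  moreover have "finite ({..<L} \<rightarrow>\<^sub>E Pow (components \<times> nodes n))"
    by (intro finite_PiE) (simp_all add: finite_nodes_delays finite_nodes)
  ultimately have finite_words: "finite (range ?word)" by (rule finite_subset)
  obtain r0 c where r0: "strict_mono (r0 :: nat \<Rightarrow> nat)" "\<forall>m. ?word (r0 m) = c"
    by (rule constant_subsequence[OF finite_words])
  have "finite ({..L} \<times> components)" by (simp add: finite_nodes_delays)
  moreover have "(case q of (s, p) \<Rightarrow> z (r0 m) s p) \<in> K" if "q \<in> {..L} \<times> components" for m q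
    using that inK[of _ "r0 m"] by auto
  ultimately obtain r1 g where r1: "strict_mono (r1 :: nat \<Rightarrow> nat)"
    "\<And>q. q \<in> {..L} \<times> components \<Longrightarrow> (\<lambda>m. (case q of (s, p) \<Rightarrow> z (r0 (r1 m)) s p)) \<longlonglongrightarrow> g q"
    using finitely_many_coordinates_subsequence[OF _ K,
        of "{..L} \<times> components" "\<lambda>m (s, p). z (r0 m) s p"] by blast
  define r where "r = r0 \<circ> r1"
  define z0 where "z0 s = restrict (\<lambda>p. g (s, p)) components" for s
  have r: "strict_mono r" unfolding r_def by (rule strict_mono_o[OF r0(1) r1(1)])
  have lim: "(\<lambda>m. z (r m) s p) \<longlonglongrightarrow> z0 s p" if "s \<le> L" "p \<in> components" for s p
    using r1(2)[of "(s, p)"] that by (simp add: r_def z0_def)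
  have word: "A (t (r m) + s) = A (t (r 0) + s)" if "s < L" for m s
    using fun_cong[OF spec[OF r0(2), of "r1 m"], of s] fun_cong[OF spec[OF r0(2), of "r1 0"], of s] that
    by (simp add: r_def)
  have states: "z (r m) s \<in> states n h" "z0 s \<in> states n h" if "s \<le> L" for m s
    using seg[of "r m"] that by (auto simp: segment_def z0_def states_def)
  have seg0: "segment (\<lambda>s. A (t (r 0) + s)) L z0"
    unfolding segment_def
  proof (intro conjI allI impI)
    fix s assume s: "s < L"
    show "z0 (Suc s) \<in> system_map n h e (A (t (r 0) + s)) (z0 s)"
    proof (rule system_map_closed_graph[OF A, of "\<lambda>m. z (r m) s" _ _ "\<lambda>m. z (r m) (Suc s)"])
      show "z (r m) (Suc s) \<in> system_map n h e (A (t (r 0) + s)) (z (r m) s)" for m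
        using seg[of "r m"] s by (simp add: segment_def word[OF s, of m, symmetric])
    qed (use s states lim in auto)
  qed (rule states)
  have hull_lim: "(\<lambda>m. hausdist (\<sigma> (vals (z (r m) s))) (\<sigma> (vals (z0 s)))) \<longlonglongrightarrow> 0" if "s \<le> L" for s
    using hausdist_tendsto_continuous[OF hull_cont vals_compact vals_compact
        hausdist_image_tendsto[OF finite_nodes_delays lim[OF that]]] .
  have "(\<lambda>m. inverse (real (Suc m))) \<longlonglongrightarrow> 0" by (rule LIMSEQ_inverse_real_of_nat)
  from LIMSEQ_subseq_LIMSEQ[OF this r]
  have drop_lim: "(\<lambda>m. inverse (real (Suc (r m)))) \<longlonglongrightarrow> 0" by (simp add: o_def)
  let ?C = "\<lambda>m s. \<sigma> (vals (z (r m) s))" and ?D = "\<lambda>s. \<sigma> (vals (z0 s))"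
  have C: "?C m s \<in> nonempty_compacts" "?D s \<in> nonempty_compacts" for m s
    by (intro hull_compact vals_compact)+
  have "hausdist (?D 0) (?D L) \<le>
      hausdist (?C m 0) (?D 0) + inverse (real (Suc (r m))) + hausdist (?C m L) (?D L)" for m
    using hausdist_triangle[OF C(2) C(1) C(2), of 0 L m 0]
      hausdist_triangle[OF C(1) C(1) C(2), of m 0 L m L]
      drop[of "r m"] hausdist_commute[of "?D 0" "?C m 0"] by linarith
  moreover have "(\<lambda>m. hausdist (?C m 0) (?D 0) + inverse (real (Suc (r m))) + hausdist (?C m L) (?D L))
      \<longlonglongrightarrow> 0 + 0 + 0"
    by (intro tendsto_add hull_lim drop_lim) auto
  ultimately have "hausdist (?D 0) (?D L) \<le> 0"
    by (intro LIMSEQ_le_const) auto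
  then have "?D L = ?D 0"
    using hausdist_eq_0_iff[OF C(2) C(2), of 0 L] hausdist_nonneg[of "?D 0" "?D L"] by simp
  moreover have "\<not> is_singleton (vals (z0 0))"
  proof
    assume "is_singleton (vals (z0 0))"
    then obtain v where "vals (z0 0) = {v}" by (rule is_singletonE)
    then have const: "z0 0 p = z0 0 (1, 0)" if "p \<in> components" for p
      using imageI[OF that, of "z0 0"] imageI[OF first_component, of "z0 0"] by simp
    have "\<forall>\<^sub>F m in sequentially. dist (z (r m) 0 (1, 0)) (z (r m) 0 p) < \<epsilon>" if "p \<in> components" for p
    proof -
      have "(\<lambda>m. dist (z (r m) 0 (1, 0)) (z (r m) 0 p)) \<longlonglongrightarrow> dist (z0 0 (1, 0)) (z0 0 p)"
        using that first_component by (intro tendsto_dist lim) auto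
      then show ?thesis using const[OF that] \<epsilon> by (intro order_tendstoD(2)) auto
    qed
    then have "\<forall>\<^sub>F m in sequentially. \<forall>p\<in>components. dist (z (r m) 0 (1, 0)) (z (r m) 0 p) < \<epsilon>"
      by (intro eventually_ball_finite finite_nodes_delays) auto
    then obtain m where "\<forall>p\<in>components. dist (z (r m) 0 (1, 0)) (z (r m) 0 p) < \<epsilon>"
      unfolding eventually_sequentially by blast
    then show False using spread[of "r m"] by force
  qed
  moreover have "\<exists>k\<in>nodes n. \<forall>l\<in>nodes n. connected_across (\<lambda>s. A (t (r 0) + s)) {a..a + T} k l" for a
  proof -
    have "{t (r 0) + a..t (r 0) + a + T} = (+) (t (r 0)) ` {a..a + T}"
      by (simp add: add.assoc)
    then have "(\<Union>s\<in>{a..a + T}. A (t (r 0) + s)) = (\<Union>s\<in>{t (r 0) + a..t (r 0) + a + T}. A s)"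
      by (metis (no_types, lifting) SUP_cong image_image)
    then show ?thesis using roots[of "t (r 0) + a"] by (simp add: connected_across_def)
  qed
  ultimately show False
    using hull_strictly_decreases[OF _ _ L seg0] A by blast
qed


section \<open>Attractivity\<close>

text \<open>Near a singleton, continuity makes the hull of a whole ball small, and by monotonicity so is
  the hull of every subset; compactness of \<open>K\<close> gives one radius for all centres.\<close>

lemma hull_of_small_set_small:
  assumes K: "compact K" and r: "r > 0"
  shows "\<exists>\<epsilon>>0. \<forall>S x. S \<in> nonempty_compacts \<longrightarrow> x \<in> K \<longrightarrow> S \<subseteq> ball x \<epsilon> \<longrightarrow>
           (\<forall>y\<in>\<sigma> S. \<forall>z\<in>\<sigma> S. dist y z < r)"
proof -
  have cball: "cball p (inverse (real (Suc m))) \<in> nonempty_compacts" for p :: 'a and m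
    by (simp add: nonempty_compacts_def)
  have sing: "{p} \<in> nonempty_compacts" for p :: 'a by (simp add: nonempty_compacts_def)
  have "\<exists>\<epsilon>>0. \<sigma> (cball p \<epsilon>) \<subseteq> ball p (r/2)" for p
  proof -
    have "hausdist (cball p (inverse (real (Suc m)))) {p} \<le> inverse (real (Suc m))" for m
      by (rule hausdist_leI) (auto simp: infdist_singleton dist_commute)
    then have "(\<lambda>m. hausdist (cball p (inverse (real (Suc m)))) {p}) \<longlonglongrightarrow> 0"
      by (intro tendsto_sandwich[OF _ _ tendsto_const LIMSEQ_inverse_real_of_nat])
         (auto simp: hausdist_nonneg)
    from hausdist_tendsto_continuous[OF hull_cont cball sing this]
    have "(\<lambda>m. hausdist (\<sigma> (cball p (inverse (real (Suc m))))) {p}) \<longlonglongrightarrow> 0"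
      using hull_singleton[OF sing] by simp
    then have "\<forall>\<^sub>F m in sequentially. hausdist (\<sigma> (cball p (inverse (real (Suc m))))) {p} < r/2"
      using r by (intro order_tendstoD(2)) auto
    then obtain m where m: "hausdist (\<sigma> (cball p (inverse (real (Suc m))))) {p} < r/2"
      unfolding eventually_sequentially by blast
    have "dist p y < r/2" if "y \<in> \<sigma> (cball p (inverse (real (Suc m))))" for y
    proof -
      have "bounded (\<sigma> (cball p (inverse (real (Suc m)))))"
        using hull_compact[OF cball] by (simp add: nonempty_compacts_def compact_imp_bounded)
      then have "infdist y {p} \<le> hausdist (\<sigma> (cball p (inverse (real (Suc m))))) {p}"
        using that by (intro hausdist_infdist_le) auto
      then show ?thesis using m by (simp add: infdist_singleton dist_commute)
    qed
    then show ?thesis by (intro exI[of _ "inverse (real (Suc m))"]) auto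
  qed
  then obtain \<eta> where \<eta>: "\<And>p. \<eta> p > 0" "\<And>p. \<sigma> (cball p (\<eta> p)) \<subseteq> ball p (r/2)" by metis
  have "K \<subseteq> \<Union>(range (\<lambda>p. ball p (\<eta> p)))"
    using \<eta>(1) centre_in_ball by blast
  then obtain \<epsilon> where \<epsilon>: "\<epsilon> > 0" "\<And>x. x \<in> K \<Longrightarrow> \<exists>G\<in>range (\<lambda>p. ball p (\<eta> p)). ball x \<epsilon> \<subseteq> G"
    by (rule Heine_Borel_lemma[OF K]) auto
  have "dist y z < r" if S: "S \<in> nonempty_compacts" "x \<in> K" "S \<subseteq> ball x \<epsilon>"
    and yz: "y \<in> \<sigma> S" "z \<in> \<sigma> S" for S x y z
  proof -
    obtain p where p: "ball x \<epsilon> \<subseteq> ball p (\<eta> p)" using \<epsilon>(2)[OF S(2)] by blast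
    have "\<sigma> S \<subseteq> \<sigma> (cball p (\<eta> p))"
      using S p \<eta>(1)[of p] ball_subset_cball[of p "\<eta> p"]
      by (intro hull_mono) (auto simp: nonempty_compacts_def less_imp_le)
    then have "dist p y < r/2" "dist p z < r/2" using \<eta>(2)[of p] yz by auto
    then show ?thesis by (rule dist_triangle_half_r)
  qed
  then show ?thesis using \<epsilon>(1) by blast
qed

text \<open>Cut time into blocks. The hulls at the block ends decrease inside a compact set, and over a
  block they drop by at least \<open>\<delta>\<close> in the Hausdorff metric as long as the values are spread
  out. So after boundedly many blocks all values are close together, and the small hull that
  they then have confines all later values.\<close>

lemma attractive_if_roots:
  assumes A: "\<And>t. delay_graph n h (A t)"
    and roots: "\<And>a. \<exists>k\<in>nodes n. \<forall>l\<in>nodes n. connected_across A {a..a + T} k l"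
  shows "uniformly_globally_attractive (states n h) (state_dist n h)
           (\<lambda>t. system_map n h e (A t)) (equilibria n h)"
  unfolding uniformly_globally_attractive_def
proof (intro ballI allI impI)
  fix \<phi>1 :: "nat \<times> nat \<Rightarrow> 'a" and c1 c2 :: real
  assume \<phi>1: "\<phi>1 \<in> equilibria n h" and c1: "c1 > 0" and c2: "c2 > 0"
  obtain c where c: "\<And>p. p \<in> components \<Longrightarrow> \<phi>1 p = c"
    using \<phi>1 by (auto simp: equilibria_def)
  define K where "K = \<sigma> (cball c c1)"
  define L where "L = h + n * n * (T + h)"
  define r where "r = c2 / (real (card components) + 1)"
  have r: "r > 0" "real (card components) * r < c2"
    using c2 by (auto simp: r_def field_simps)
  have cball: "cball c c1 \<in> nonempty_compacts" using c1 by (auto simp: nonempty_compacts_def)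
  have K: "compact K" using hull_compact[OF cball] by (simp add: K_def nonempty_compacts_def)
  obtain \<epsilon> where \<epsilon>: "\<epsilon> > 0"
      "\<forall>S x. S \<in> nonempty_compacts \<longrightarrow> x \<in> K \<longrightarrow> S \<subseteq> ball x \<epsilon> \<longrightarrow>
         (\<forall>y\<in>\<sigma> S. \<forall>z\<in>\<sigma> S. dist y z < r)"
    using hull_of_small_set_small[OF K r(1)] by (elim exE conjE)
  obtain \<delta> where \<delta>: "\<delta> > 0" "\<And>t z p. segment (\<lambda>s. A (t + s)) L z \<Longrightarrow>
      (\<And>s. s \<le> L \<Longrightarrow> vals (z s) \<subseteq> K) \<Longrightarrow> p \<in> components \<Longrightarrow> \<epsilon> \<le> dist (z 0 (1, 0)) (z 0 p) \<Longrightarrow>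
      \<delta> \<le> hausdist (\<sigma> (vals (z 0))) (\<sigma> (vals (z L)))"
    using hull_drop_uniform[OF A roots L_def K \<epsilon>(1)] by metis
  obtain N :: nat where N: "\<And>C. (\<And>i. C i \<in> nonempty_compacts \<and> C i \<subseteq> K \<and> C (Suc i) \<subseteq> C i) \<Longrightarrow>
      \<exists>i\<le>N. hausdist (C i) (C (Suc i)) < \<delta>"
    using decreasing_compacts_small_drop[OF K \<delta>(1)] by metis
  show "\<exists>T. \<forall>t0 \<zeta>. inclusion_solution (states n h) (\<lambda>t. system_map n h e (A t)) t0 \<zeta> \<longrightarrow>
      state_dist n h (\<zeta> t0) \<phi>1 < c1 \<longrightarrow>
      (\<exists>\<phi>2\<in>equilibria n h. \<forall>t\<ge>t0 + T. state_dist n h (\<zeta> t) \<phi>2 < c2)"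
  proof (intro exI[of _ "N * L"] allI impI)
    fix t0 \<zeta>
    assume sol: "inclusion_solution (states n h) (\<lambda>t. system_map n h e (A t)) t0 \<zeta>"
      and near: "state_dist n h (\<zeta> t0) \<phi>1 < c1"
    have dec: "\<sigma> (vals (\<zeta> t')) \<subseteq> \<sigma> (vals (\<zeta> t))" if "t0 \<le> t" "t \<le> t'" for t t'
      using segment_hull_decreasing[OF _ segment_of_solution[OF sol that(1)], of 0 "t' - t" "t' - t"]
        A that by simp
    have "vals (\<zeta> t0) \<subseteq> cball c c1"
      using norm_component_le_state_dist[of _ n h "\<zeta> t0" \<phi>1] near c
      by (force simp: dist_norm norm_minus_commute)
    then have "\<sigma> (vals (\<zeta> t0)) \<subseteq> K"
      unfolding K_def by (rule hull_mono[OF cball vals_compact])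
    then have hullK: "\<sigma> (vals (\<zeta> t)) \<subseteq> K" if "t0 \<le> t" for t
      using dec[OF order_refl that] by blast
    have inK: "vals (\<zeta> t) \<subseteq> K" if "t0 \<le> t" for t
      using hullK[OF that] hull_extensive[OF vals_compact, of "\<zeta> t"] by blast
    have "\<exists>i\<le>N. hausdist (\<sigma> (vals (\<zeta> (t0 + i * L)))) (\<sigma> (vals (\<zeta> (t0 + Suc i * L)))) < \<delta>"
      by (rule N) (intro conjI hull_compact vals_compact hullK dec; simp)
    then obtain i where i: "i \<le> N"
      "hausdist (\<sigma> (vals (\<zeta> (t0 + i * L)))) (\<sigma> (vals (\<zeta> (t0 + Suc i * L)))) < \<delta>" by blast
    define t where "t = t0 + i * L"
    have t: "t0 \<le> t" "t \<le> t0 + N * L" using i(1) by (auto simp: t_def)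
    have next_block: "t0 + Suc i * L = t + L" by (simp add: t_def)
    have close: "dist (\<zeta> t (1, 0)) (\<zeta> t p) < \<epsilon>" if "p \<in> components" for p
    proof (rule ccontr)
      assume "\<not> ?thesis"
      then have "\<delta> \<le> hausdist (\<sigma> (vals (\<zeta> (t + 0)))) (\<sigma> (vals (\<zeta> (t + L))))"
        using \<delta>(2)[OF segment_of_solution[OF sol t(1)], of p] inK t(1) that by auto
      then show False using i(2) unfolding next_block by (simp add: t_def)
    qed
    let ?c = "\<zeta> t (1, 0)"
    have c_val: "?c \<in> vals (\<zeta> t)" by (rule imageI[OF first_component])
    have small: "dist y z < r" if "y \<in> \<sigma> (vals (\<zeta> t))" "z \<in> \<sigma> (vals (\<zeta> t))" for y z
    proof -
      have "vals (\<zeta> t) \<subseteq> ball ?c \<epsilon>" using close by auto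
      moreover have "?c \<in> K" using inK[OF t(1)] c_val by blast
      ultimately show ?thesis
        using \<epsilon>(2) vals_compact that by metis
    qed
    show "\<exists>\<phi>2\<in>equilibria n h. \<forall>t\<ge>t0 + N * L. state_dist n h (\<zeta> t) \<phi>2 < c2"
    proof (intro bexI[of _ "restrict (\<lambda>_. ?c) components"] allI impI)
      fix t' assume "t' \<ge> t0 + N * L"
      then have "t \<le> t'" using t(2) by simp
      have "norm (\<zeta> t' p - restrict (\<lambda>_. ?c) components p) \<le> r" if "p \<in> components" for p
      proof -
        have "\<zeta> t' p \<in> \<sigma> (vals (\<zeta> t))"
          using dec[OF t(1) \<open>t \<le> t'\<close>] hull_extensive[OF vals_compact, of "\<zeta> t'"] that by blast
        moreover have "?c \<in> \<sigma> (vals (\<zeta> t))"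
          using hull_extensive[OF vals_compact, of "\<zeta> t"] c_val by blast
        ultimately show ?thesis using small that by (simp add: dist_norm less_imp_le)
      qed
      then show "state_dist n h (\<zeta> t') (restrict (\<lambda>_. ?c) components) < c2"
        by (rule state_dist_lessI[OF c2 _ r(2)])
    qed (auto simp: equilibria_def states_def)
  qed
qed


section \<open>Necessity of the connectivity condition\<close>

lemma solution_exists:
  assumes A: "\<And>t. delay_graph n h (A t)" and x: "x \<in> states n h"
  shows "\<exists>\<zeta>. inclusion_solution (states n h) (\<lambda>t. system_map n h e (A t)) t0 \<zeta> \<and> \<zeta> t0 = x"
proof -
  have "\<exists>y. y \<in> states n h \<and> y \<in> system_map n h e (A (t0 + m)) x" if "x \<in> states n h" for m x
    using system_map_nonempty[OF A that, of "t0 + m"] by (auto simp: system_map_def)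
  then have "\<exists>f. \<forall>m. (f m \<in> states n h \<and> (m = 0 \<longrightarrow> f m = x)) \<and>
      f (Suc m) \<in> system_map n h e (A (t0 + m)) (f m)"
    using x by (intro dependent_nat_choice) auto
  then obtain f where f: "f m \<in> states n h" "f 0 = x"
    "f (Suc m) \<in> system_map n h e (A (t0 + m)) (f m)" for m
    by blast
  have "f (Suc t - t0) \<in> system_map n h e (A t) (f (t - t0))" if "t0 \<le> t" for t
    using f(3)[of "t - t0"] that by (simp add: Suc_diff_le)
  then show ?thesis
    using f by (intro exI[of _ "\<lambda>t. f (t - t0)"]) (simp add: inclusion_solution_def)
qed

lemma agreement_persists:
  assumes B: "\<And>s. delay_graph n h (B s)" and z: "segment B L z"
    and closed: "\<And>s i j k. s < L \<Longrightarrow> ((i, j), k) \<in> B s \<Longrightarrow> k \<in> P \<Longrightarrow> i \<in> P"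
    and P: "P \<subseteq> nodes n" and init: "\<And>k j. k \<in> P \<Longrightarrow> j < h \<Longrightarrow> z 0 (k, j) = v"
    and s: "s \<le> L" and k: "k \<in> P" "j < h"
  shows "z s (k, j) = v"
  using s k
proof (induction s arbitrary: k j)
  case 0
  then show ?case using init by simp
next
  case (Suc s)
  have step: "z (Suc s) \<in> system_map n h e (B s) (z s)" and state: "z s \<in> states n h"
    using z Suc.prems by (auto simp: segment_def)
  have k: "k \<in> nodes n" using P Suc.prems by blast
  show ?case
  proof (cases j)
    case 0
    have "z s (i, j) = v" if "((i, j), k) \<in> B s" for i j
      using Suc.IH[of i j] closed[of s i j k] that Suc.prems B[of s]
      by (auto simp: delay_graph_def delays_def)
    moreover have "z s (k, 0) = v" using Suc.IH[of k 0] Suc.prems h by simp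
    ultimately have "neighbour_values (B s) k (z s) \<subseteq> {z s (k, 0)}" and "z s (k, 0) = v"
      by (auto simp: neighbour_values_def)
    then show ?thesis
      using update_agreement[OF k B state] step k 0 by (auto simp: system_map_def)
  next
    case (Suc i)
    then have "z (Suc s) (k, j) = z s (k, i)"
      using step k \<open>j < h\<close> by (auto simp: system_map_def)
    then show ?thesis using Suc.IH[of k i] Suc.prems Suc by simp
  qed
qed

text \<open>Without a root there are two disjoint sets of nodes that receive no information from
  outside. Agents that start at one point in the first set and at another in the second never
  move while this lasts.\<close>

lemma roots_if_attractive:
  assumes A: "\<And>t. delay_graph n h (A t)"
    and attr: "uniformly_globally_attractive (states n h) (state_dist n h)
           (\<lambda>t. system_map n h e (A t)) (equilibria n h)"
  shows "\<exists>T::nat. \<forall>t0. \<exists>k\<in>nodes n. \<forall>l\<in>nodes n. connected_across A {t0..t0 + T} k l"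
proof -
  obtain b :: 'a where b: "norm b = 1" using nonempty_Basis norm_Basis by blast
  define \<phi>1 :: "nat \<times> nat \<Rightarrow> 'a" where "\<phi>1 = restrict (\<lambda>_. 0) components"
  define c1 where "c1 = real (card components) + 1"
  have "\<phi>1 \<in> equilibria n h" "c1 > 0" by (auto simp: \<phi>1_def c1_def equilibria_def states_def)
  (* The bound c1 must not depend on the sets of nodes found below: those depend on the time t0,
     which is only known after T. *)
  then obtain T :: nat where T: "\<And>t0 \<zeta>.
      inclusion_solution (states n h) (\<lambda>t. system_map n h e (A t)) t0 \<zeta> \<Longrightarrow>
      state_dist n h (\<zeta> t0) \<phi>1 < c1 \<Longrightarrow>
      \<exists>\<phi>2\<in>equilibria n h. \<forall>t\<ge>t0 + T. state_dist n h (\<zeta> t) \<phi>2 < 1/2"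
    using attr unfolding uniformly_globally_attractive_def
    by (metis half_gt_zero_iff zero_less_one)
  have "\<exists>k\<in>nodes n. \<forall>l\<in>nodes n. connected_across A {t0..t0 + T} k l" for t0
  proof (rule ccontr)
    assume no_root: "\<not> ?thesis"
    let ?R = "{(i, m). \<exists>j. ((i, j), m) \<in> (\<Union>t\<in>{t0..t0 + T}. A t)}"
    have R: "?R \<subseteq> nodes n \<times> nodes n" using A by (fastforce simp: delay_graph_def)
    have unreached: "\<exists>l\<in>nodes n. (k, l) \<notin> ?R\<^sup>*" if "k \<in> nodes n" for k
      using no_root that by (auto simp: connected_across_def node_connected_def)
    have nonempty: "nodes n \<noteq> {}" using n by (simp add: nodes_def)
    obtain P Q where PQ: "P \<subseteq> nodes n" "Q \<subseteq> nodes n" "P \<noteq> {}" "Q \<noteq> {}" "P \<inter> Q = {}"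
      "?R\<inverse> `` P \<subseteq> P" "?R\<inverse> `` Q \<subseteq> Q"
      by (rule no_root_disjoint_ancestor_closed[OF finite_nodes nonempty R unreached])
    define x where "x = restrict (\<lambda>(k, j). if k \<in> P then b else 0) components"
    have "x \<in> states n h" by (auto simp: x_def states_def)
    then obtain \<zeta> where sol: "inclusion_solution (states n h) (\<lambda>t. system_map n h e (A t)) t0 \<zeta>"
      and \<zeta>: "\<zeta> t0 = x"
      using solution_exists[where A = A and ?t0.0 = t0, OF A] by metis
    have "state_dist n h x \<phi>1 < c1"
      by (rule state_dist_lessI[where r = 1]) (auto simp: x_def \<phi>1_def c1_def b)
    then obtain \<phi>2 where "\<phi>2 \<in> equilibria n h" and \<phi>2: "state_dist n h (\<zeta> (t0 + T)) \<phi>2 < 1/2"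
      using T[OF sol] \<zeta> by auto
    then obtain c where c: "\<And>p. p \<in> components \<Longrightarrow> \<phi>2 p = c" by (auto simp: equilibria_def)
    have near_c: "norm (v - c) < 1/2"
      if k: "k \<in> D" and v: "\<zeta> (t0 + T) (k, 0) = v" and D: "D \<subseteq> nodes n" for k v D
      using norm_component_le_state_dist[of "(k, 0)" n h "\<zeta> (t0 + T)" \<phi>2] component_0[of k]
        c \<phi>2 that by (auto simp: subset_iff)
    have seg: "segment (\<lambda>s. A (t0 + s)) T (\<lambda>s. \<zeta> (t0 + s))"
      by (rule segment_of_solution[OF sol order_refl])
    have stay: "\<zeta> (t0 + T) (k, 0) = v"
      if D: "D \<subseteq> nodes n" "?R\<inverse> `` D \<subseteq> D" "k \<in> D"
        and v: "\<And>k j. k \<in> D \<Longrightarrow> j < h \<Longrightarrow> x (k, j) = v" for D v k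
    proof (rule agreement_persists[OF A seg _ D(1)])
      fix s i j m assume s: "s < T" "((i, j), m) \<in> A (t0 + s)" "m \<in> D"
      have "t0 + s \<in> {t0..t0 + T}" using s(1) by simp
      then have "(i, m) \<in> ?R" using s(2) by blast
      then show "i \<in> D" using D(2) s(3) by blast
    qed (use D v \<zeta> h in auto)
    obtain k l where kl: "k \<in> P" "l \<in> Q" using PQ by blast
    have "\<zeta> (t0 + T) (k, 0) = b"
      using PQ kl(1) by (intro stay[of P]) (auto simp: x_def delays_def)
    moreover have "\<zeta> (t0 + T) (l, 0) = 0"
      using PQ kl(2) by (intro stay[of Q]) (auto simp: x_def delays_def)
    ultimately have "norm (b - c) < 1/2" "norm (0 - c) < 1/2"
      using near_c kl PQ by blast+
    then show False using norm_triangle_ineq4[of "b - c" "0 - c"] b by simp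
  qed
  then show ?thesis by blast
qed

end

section \<open>The consensus theorem\<close>

theorem theorem2:
  fixes \<sigma> :: "'a::euclidean_space set \<Rightarrow> 'a set"
    and e :: "nat \<Rightarrow> ((nat \<times> nat) \<times> nat) set \<Rightarrow> (nat \<times> nat \<Rightarrow> 'a) \<Rightarrow> 'a set"
    and \<A> :: "nat \<Rightarrow> ((nat \<times> nat) \<times> nat) set"
    and n h :: nat
  assumes n: "n \<ge> 1" and h: "h \<ge> 1"
    and \<sigma>_sets: "\<sigma> ` nonempty_compacts \<subseteq> lipeo_convex_sets"
    and \<sigma>_cont: "continuous_map hausdorff_topology hausdorff_topology \<sigma>"
    and \<sigma>1: "\<And>S. S \<in> nonempty_compacts \<Longrightarrow> S \<subseteq> \<sigma> S"
            "\<And>S. S \<in> nonempty_compacts \<Longrightarrow> is_singleton S \<Longrightarrow> \<sigma> S = S"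
    and \<sigma>2: "\<And>S. S \<in> nonempty_compacts \<Longrightarrow> \<sigma> (\<sigma> S) = \<sigma> S"
    and \<sigma>3: "\<And>S S'. S \<in> nonempty_compacts \<Longrightarrow> S' \<in> nonempty_compacts \<Longrightarrow>
               S' \<subseteq> S \<Longrightarrow> \<sigma> S' \<subseteq> \<sigma> S"
    and \<sigma>4: "\<And>S x. S \<in> nonempty_compacts \<Longrightarrow> \<not> is_singleton S \<Longrightarrow> x \<in> S \<Longrightarrow>
               \<exists>\<Sigma>. \<Sigma> \<subseteq> rbd (\<sigma> S) \<and> \<Sigma> \<inter> S \<noteq> {} \<and> x \<notin> \<Sigma> \<and>
                 (\<forall>S'\<in>nonempty_compacts. S' \<subseteq> \<sigma> S \<longrightarrow>
                    (ri (\<sigma> S') \<inter> \<Sigma> \<noteq> {} \<longrightarrow> S' \<subseteq> \<Sigma>) \<and>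
                    (intrinsic_setdist (\<sigma> S) S' \<Sigma> > 0 \<longrightarrow>
                       intrinsic_diameter (\<sigma> S') < intrinsic_diameter (\<sigma> S)))"
    and \<sigma>5: "continuous_map hausdorff_topology euclideanreal (intrinsic_diameter \<circ> \<sigma>)"
    and e_cont: "\<And>k A. k \<in> nodes n \<Longrightarrow> delay_graph n h A \<Longrightarrow>
               set_valued_continuous (state_topology n h) euclidean (e k A)"
    and e_compact: "\<And>k A x. k \<in> nodes n \<Longrightarrow> delay_graph n h A \<Longrightarrow> x \<in> states n h \<Longrightarrow>
               e k A x \<in> nonempty_compacts"
    and e_i: "\<And>k A x. k \<in> nodes n \<Longrightarrow> delay_graph n h A \<Longrightarrow> x \<in> states n h \<Longrightarrow>
               neighbour_values A k x \<subseteq> {x (k, 0)} \<Longrightarrow> e k A x = {x (k, 0)}"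
    and e_ii: "\<And>k A x. k \<in> nodes n \<Longrightarrow> delay_graph n h A \<Longrightarrow> x \<in> states n h \<Longrightarrow>
               \<not> neighbour_values A k x \<subseteq> {x (k, 0)} \<Longrightarrow>
               e k A x \<subset> ri (\<sigma> ({x (k, 0)} \<union> neighbour_values A k x))"
    and \<A>: "\<And>t. delay_graph n h (\<A> t)"
  shows "uniformly_globally_attractive (states n h) (state_dist n h)
           (\<lambda>t. system_map n h e (\<A> t)) (equilibria n h) \<longleftrightarrow>
         (\<exists>T::nat. \<forall>t0. \<exists>k\<in>nodes n. \<forall>l\<in>nodes n - {k}.
            connected_across \<A> {t0..t0 + T} k l)"
proof -
  interpret hull_system \<sigma> e n h
  proof unfold_locales
    fix S :: "'a set" and x
    assume "S \<in> nonempty_compacts" "\<not> is_singleton S" "x \<in> S"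
    from \<sigma>4[OF this] obtain \<Sigma> where \<Sigma>: "\<Sigma> \<inter> S \<noteq> {}" "x \<notin> \<Sigma>"
      "\<forall>S'\<in>nonempty_compacts. S' \<subseteq> \<sigma> S \<longrightarrow> (ri (\<sigma> S') \<inter> \<Sigma> \<noteq> {} \<longrightarrow> S' \<subseteq> \<Sigma>) \<and>
        (intrinsic_setdist (\<sigma> S) S' \<Sigma> > 0 \<longrightarrow>
           intrinsic_diameter (\<sigma> S') < intrinsic_diameter (\<sigma> S))"
      by (elim exE conjE)
    then have "face_like \<sigma> (\<sigma> S) \<Sigma>" unfolding face_like_def by simp
    then show "\<exists>\<Sigma>. face_like \<sigma> (\<sigma> S) \<Sigma> \<and> \<Sigma> \<inter> S \<noteq> {} \<and> x \<notin> \<Sigma>"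
      using \<Sigma>(1,2) by (intro exI[of _ \<Sigma>] conjI)
  qed (fact n h \<sigma>_sets \<sigma>_cont \<sigma>1 \<sigma>2 \<sigma>3 e_cont e_compact e_i e_ii)+
  have reflexive: "connected_across \<A> I k k" for I k
    by (simp add: connected_across_def node_connected_def)
  show ?thesis
  proof
    assume "uniformly_globally_attractive (states n h) (state_dist n h)
              (\<lambda>t. system_map n h e (\<A> t)) (equilibria n h)"
    from roots_if_attractive[OF \<A> this]
    show "\<exists>T::nat. \<forall>t0. \<exists>k\<in>nodes n. \<forall>l\<in>nodes n - {k}. connected_across \<A> {t0..t0 + T} k l"
      by blast
  next
    assume "\<exists>T::nat. \<forall>t0. \<exists>k\<in>nodes n. \<forall>l\<in>nodes n - {k}. connected_across \<A> {t0..t0 + T} k l"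
    then obtain T :: nat where
      "\<And>t0. \<exists>k\<in>nodes n. \<forall>l\<in>nodes n - {k}. connected_across \<A> {t0..t0 + T} k l" by blast
    then have "\<exists>k\<in>nodes n. \<forall>l\<in>nodes n. connected_across \<A> {t0..t0 + T} k l" for t0
      using reflexive by (metis Diff_iff singletonD)
    then show "uniformly_globally_attractive (states n h) (state_dist n h)
              (\<lambda>t. system_map n h e (\<A> t)) (equilibria n h)"
      by (rule attractive_if_roots[OF \<A>])
  qed
qed

end
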